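(* For every $z \in \overline{B}_{\ell_\infty}$ there is a map $$\Phi_z: (\beta(\mathbb{N})\setminus \mathbb{N}) \times B_{\ell_\infty} \to \pi^{-1}(z) \subset \mathcal{M}_\infty(B_{c_0})$$ satisfying: (1) For all $\eta \in \beta(\mathbb{N}) \setminus \mathbb{N}$, the mapping $\Phi_z^\eta: B_{\ell_\infty}\to \pi^{-1}(z)$ given by $\Phi_z^\eta(w) = \Phi_z(\eta,w)$ is an analytic Gleason isometry. (2) If $\eta_1 \neq \eta_2$ are in $\beta(\mathbb{N}) \setminus \mathbb{N}$, then the images $\Phi_z^{\eta_1}(B_{\ell_\infty})$ and $\Phi_z^{\eta_2}(B_{\ell_\infty})$ lie in different Gleason parts (of $\mathcal{M}_\infty(B_{c_0})$).
   Context: All Banach spaces are complex. $B_X$ and $\overline{B}_X$ denote the open and closed unit balls of a Banach space $X$. $\mathcal{H}^\infty(B_{c_0})$ is the Banach algebra of bounded holomorphic functions $B_{c_0}\to\mathbb{C}$ with the sup norm, and $\mathcal{M}_\infty(B_{c_0})$ is its spectrum, i.e. the set of nonzero algebra homomorphisms $\varphi:\mathcal{H}^\infty(B_{c_0})\to\mathbb{C}$. Since $c_0^*=\ell_1\subset\mathcal{H}^\infty(B_{c_0})$, there is a projection $\pi:\mathcal{M}_\infty(B_{c_0})\to\overline{B}_{\ell_\infty}$, $\pi(\varphi)=\varphi|_{\ell_1}\in\ell_1^*=\ell_\infty$; the fiber over $z\in\overline{B}_{\ell_\infty}$ is $\pi^{-1}(z)=\{\varphi:\pi(\varphi)=z\}$.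 The canonical (Aron–Berner/Davie–Gamelin) extension $f\mapsto\widetilde f$ is an isometric algebra homomorphism from $\mathcal{H}^\infty(B_{c_0})$ to $\mathcal{H}^\infty(B_{\ell_\infty})$ (concretely, $\widetilde f(w)=\lim_n f(w_1,\dots,w_n,0,0,\dots)$). For $w\in B_{\ell_\infty}$, $\delta_w\in\mathcal{M}_\infty(B_{c_0})$ is $\delta_w(f)=\widetilde f(w)$. The Gleason metric on $\mathcal{M}_\infty(B_{c_0})$ is $\|\varphi-\psi\|$, the norm being that of $\mathcal{H}^\infty(B_{c_0})^*$. The Gleason part of $\varphi$ is $\{\psi\in\mathcal{M}_\infty(B_{c_0}):\|\varphi-\psi\|<2\}$; Gleason parts form a partition of $\mathcal{M}_\infty(B_{c_0})$. A map $F:B_{\ell_\infty}\to\mathcal{M}_\infty(B_{c_0})$ is a Gleason isometry if $\|F(w)-F(v)\|=\|\delta_w-\delta_v\|$ for all $w,v\in B_{\ell_\infty}$, and it is analytic if $w\mapsto F(w)(f)$ is holomorphic on $B_{\ell_\infty}$ for every $f\in\mathcal{H}^\infty(B_{c_0})$. The image of a Gleason isometry from $B_{\ell_\infty}$ is contained in a single Gleason part; two such images lie in different Gleason parts when no element of one is in the Gleason part of an element of the other. $\beta(\mathbb{N})$ is the Stone–Čech compactification of $\mathbb{N}$. *)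

theory Defs
  imports "HOL-Analysis.Analysis"
begin

section \<open>Complex normed spaces and holomorphic functions on them\<close>

class complex_normed_vector = real_normed_vector +
  fixes scaleC :: "complex \<Rightarrow> 'a \<Rightarrow> 'a"  (infixr \<open>*\<^sub>C\<close> 75)
  assumes scaleC_add_right: "c *\<^sub>C (x + y) = c *\<^sub>C x + c *\<^sub>C y"
    and scaleC_add_left: "(c + d) *\<^sub>C x = c *\<^sub>C x + d *\<^sub>C x"
    and scaleC_scaleC: "c *\<^sub>C d *\<^sub>C x = (c * d) *\<^sub>C x"
    and scaleR_scaleC: "scaleR r x = complex_of_real r *\<^sub>C x"
    and norm_scaleC: "norm (c *\<^sub>C x) = norm c * norm x"

text \<open>
  Holomorphy is complex Frechet differentiability. The derivative \<open>(at x)\<close> is not relative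
  to \<open>S\<close>, so the notion is meant for open \<open>S\<close>.
\<close>

definition fholomorphic_on :: "('a::complex_normed_vector \<Rightarrow> complex) \<Rightarrow> 'a set \<Rightarrow> bool"
    (infixl \<open>fholomorphic'_on\<close> 50) where
  "f fholomorphic_on S \<longleftrightarrow>
     (\<forall>x\<in>S. \<exists>D. (f has_derivative D) (at x) \<and> (\<forall>c h. D (c *\<^sub>C h) = c * D h))"


section \<open>The spaces \<open>\<ell>\<^sub>\<infinity>\<close> and \<open>c\<^sub>0\<close>\<close>

text \<open>
  As \<open>nat\<close> is discrete, bounded continuous functions on it are exactly the bounded sequences,
  and the library's norm on them is the supremum norm. Coordinates are indexed from \<open>0\<close>.
\<close>

type_synonym linf = "nat \<Rightarrow>\<^sub>C complex"

instantiation bcontfun :: (topological_space, complex_normed_vector) complex_normed_vector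
begin

definition scaleC_bcontfun :: "complex \<Rightarrow> ('a \<Rightarrow>\<^sub>C 'b) \<Rightarrow> ('a \<Rightarrow>\<^sub>C 'b)" where
  "scaleC_bcontfun c f = Bcontfun (\<lambda>x. c *\<^sub>C apply_bcontfun f x)"

lemma bounded_linear_scaleC: "bounded_linear (\<lambda>x::'b. c *\<^sub>C x)"
proof
  show "c *\<^sub>C (x + y) = c *\<^sub>C x + c *\<^sub>C y" for x y :: 'b
    by (rule scaleC_add_right)
  show "c *\<^sub>C (r *\<^sub>R x) = r *\<^sub>R (c *\<^sub>C x)" for r and x :: 'b
    by (simp add: scaleR_scaleC scaleC_scaleC mult.commute)
  show "\<exists>K. \<forall>x::'b. norm (c *\<^sub>C x) \<le> norm x * K"
    by (rule exI[of _ "norm c"]) (simp add: norm_scaleC mult.commute)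
qed

lemma apply_bcontfun_scaleC [simp]:
  fixes f :: "'a \<Rightarrow>\<^sub>C 'b"
  shows "apply_bcontfun (c *\<^sub>C f) x = c *\<^sub>C apply_bcontfun f x"
proof -
  have "(\<lambda>x. c *\<^sub>C apply_bcontfun f x) \<in> bcontfun"
  proof (rule bcontfun_normI)
    show "continuous_on UNIV (\<lambda>x. c *\<^sub>C apply_bcontfun f x)"
      by (intro bounded_linear.continuous_on[OF bounded_linear_scaleC]
          continuous_on_apply_bcontfun)
    show "norm (c *\<^sub>C apply_bcontfun f x) \<le> norm c * norm f" for x
      by (simp add: norm_scaleC mult_left_mono norm_bounded)
  qed
  then show ?thesis
    by (simp add: scaleC_bcontfun_def Bcontfun_inverse)
qed

instance
proof
  fix c d :: complex and f g :: "'a \<Rightarrow>\<^sub>C 'b" and r :: real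
  show "c *\<^sub>C (f + g) = c *\<^sub>C f + c *\<^sub>C g"
    by (rule bcontfun_eqI) (simp add: scaleC_add_right)
  show "(c + d) *\<^sub>C f = c *\<^sub>C f + d *\<^sub>C f"
    by (rule bcontfun_eqI) (simp add: scaleC_add_left)
  show *: "c *\<^sub>C d *\<^sub>C f = (c * d) *\<^sub>C f" for c d and f :: "'a \<Rightarrow>\<^sub>C 'b"
    by (rule bcontfun_eqI) (simp add: scaleC_scaleC)
  show "r *\<^sub>R f = complex_of_real r *\<^sub>C f"
    by (rule bcontfun_eqI) (simp add: scaleR_scaleC)
  have le: "norm (c *\<^sub>C f) \<le> norm c * norm f" for c and f :: "'a \<Rightarrow>\<^sub>C 'b"
    by (rule norm_bound) (simp add: norm_scaleC mult_left_mono norm_bounded)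
  show "norm (c *\<^sub>C f) = norm c * norm f"
  proof (cases "c = 0")
    case True
    then show ?thesis using le[of c f] by simp
  next
    case False
    have "inverse c *\<^sub>C c *\<^sub>C f = f"
      using False by (intro bcontfun_eqI)
        (metis * apply_bcontfun_scaleC left_inverse of_real_1 scaleR_one scaleR_scaleC)
    then have "norm f \<le> norm (inverse c) * norm (c *\<^sub>C f)"
      using le[of "inverse c" "c *\<^sub>C f"] by simp
    then have "norm c * norm f \<le> norm c * (norm (inverse c) * norm (c *\<^sub>C f))"
      by (rule mult_left_mono) simp
    also have "\<dots> = norm (c *\<^sub>C f)"
      using False by (simp add: norm_inverse)
    finally show ?thesis using le[of c f] by simp
  qed
qed

end

instantiation complex :: complex_normed_vector
begin

definition scaleC_complex :: "complex \<Rightarrow> complex \<Rightarrow> complex" where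
  [simp]: "scaleC_complex c x = c * x"

instance
  by standard (simp_all add: algebra_simps norm_mult scaleR_conv_of_real)

end

typedef c0 = "{x :: linf. apply_bcontfun x \<longlonglongrightarrow> 0}"
  by (rule exI[of _ 0]) simp

abbreviation c0_nth :: "c0 \<Rightarrow> nat \<Rightarrow> complex" where
  "c0_nth x \<equiv> apply_bcontfun (Rep_c0 x)"

lemma c0_nth_tendsto_0: "c0_nth x \<longlonglongrightarrow> 0"
  using Rep_c0[of x] by simp

lemma c0_eqI: "Rep_c0 x = Rep_c0 y \<Longrightarrow> x = y"
  by (simp add: Rep_c0_inject)

instantiation c0 :: complex_normed_vector
begin

definition "0 = Abs_c0 0"
definition "x + y = Abs_c0 (Rep_c0 x + Rep_c0 y)"
definition "x - y = Abs_c0 (Rep_c0 x - Rep_c0 y)"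
definition "- x = Abs_c0 (- Rep_c0 x)"
definition "r *\<^sub>R x = Abs_c0 (r *\<^sub>R Rep_c0 x)"
definition "c *\<^sub>C x = Abs_c0 (c *\<^sub>C Rep_c0 x)"
definition "norm x = norm (Rep_c0 x)"
definition "sgn (x::c0) = inverse (norm x) *\<^sub>R x"
definition "dist x y = dist (Rep_c0 x) (Rep_c0 y)"
definition "(uniformity :: (c0 \<times> c0) filter)
  = (INF e\<in>{0<..}. principal {(x, y). dist x y < e})"
definition "open (S :: c0 set) \<longleftrightarrow> (\<forall>x\<in>S. \<forall>\<^sub>F (x', y) in uniformity. x' = x \<longrightarrow> y \<in> S)"

lemma Rep_c0_simps [simp]:
  "Rep_c0 0 = 0"
  "Rep_c0 (x + y) = Rep_c0 x + Rep_c0 y"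
  "Rep_c0 (x - y) = Rep_c0 x - Rep_c0 y"
  "Rep_c0 (- x) = - Rep_c0 x"
  "Rep_c0 (r *\<^sub>R x) = r *\<^sub>R Rep_c0 x"
  "Rep_c0 (c *\<^sub>C x) = c *\<^sub>C Rep_c0 x"
proof -
  note t = c0_nth_tendsto_0[of x] c0_nth_tendsto_0[of y]
  show "Rep_c0 0 = 0"
    by (simp add: zero_c0_def Abs_c0_inverse)
  show "Rep_c0 (x + y) = Rep_c0 x + Rep_c0 y"
    using tendsto_add[OF t] by (simp add: plus_c0_def Abs_c0_inverse plus_bcontfun.rep_eq)
  show "Rep_c0 (x - y) = Rep_c0 x - Rep_c0 y"
    using tendsto_diff[OF t] by (simp add: minus_c0_def Abs_c0_inverse minus_bcontfun.rep_eq)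
  show "Rep_c0 (- x) = - Rep_c0 x"
    using tendsto_minus[OF t(1)] by (simp add: uminus_c0_def Abs_c0_inverse)
  show "Rep_c0 (r *\<^sub>R x) = r *\<^sub>R Rep_c0 x"
    using tendsto_scaleR[OF tendsto_const[of r] t(1)]
    by (simp add: scaleR_c0_def Abs_c0_inverse)
  have "(\<lambda>n. apply_bcontfun (c *\<^sub>C Rep_c0 x) n) \<longlonglongrightarrow> 0"
    using tendsto_mult_right_zero[OF t(1), of c] by simp
  then have "Rep_c0 (Abs_c0 (c *\<^sub>C Rep_c0 x)) = c *\<^sub>C Rep_c0 x"
    by (intro Abs_c0_inverse CollectI)
  then show "Rep_c0 (c *\<^sub>C x) = c *\<^sub>C Rep_c0 x"
    by (simp only: scaleC_c0_def)
qed

instance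
proof
  fix x y z :: c0 and a b :: real and c d :: complex
  show "x + y + z = x + (y + z)" by (rule c0_eqI) (simp add: add.assoc)
  show "x + y = y + x" by (rule c0_eqI) (simp add: add.commute)
  show "0 + x = x" by (rule c0_eqI) simp
  show "- x + x = 0" by (rule c0_eqI) simp
  show "x - y = x + - y" by (rule c0_eqI) simp
  show "a *\<^sub>R (x + y) = a *\<^sub>R x + a *\<^sub>R y" by (rule c0_eqI) (simp add: scaleR_add_right)
  show "(a + b) *\<^sub>R x = a *\<^sub>R x + b *\<^sub>R x" by (rule c0_eqI) (simp add: scaleR_add_left)
  show "a *\<^sub>R b *\<^sub>R x = (a * b) *\<^sub>R x" by (rule c0_eqI) simp
  show "1 *\<^sub>R x = x" by (rule c0_eqI) simp
  show "dist x y = norm (x - y)" by (simp add: dist_c0_def norm_c0_def dist_norm)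
  show "sgn x = inverse (norm x) *\<^sub>R x" by (rule sgn_c0_def)
  show "(uniformity :: (c0 \<times> c0) filter) = (INF e\<in>{0<..}. principal {(x, y). dist x y < e})"
    by (rule uniformity_c0_def)
  show "open S \<longleftrightarrow> (\<forall>x\<in>S. \<forall>\<^sub>F (x', y) in uniformity. x' = x \<longrightarrow> y \<in> S)" for S :: "c0 set"
    by (rule open_c0_def)
  show "norm x = 0 \<longleftrightarrow> x = 0" by (simp add: norm_c0_def flip: Rep_c0_inject)
  show "norm (x + y) \<le> norm x + norm y" by (simp add: norm_c0_def norm_triangle_ineq)
  show "norm (a *\<^sub>R x) = \<bar>a\<bar> * norm x" by (simp add: norm_c0_def)
  show "c *\<^sub>C (x + y) = c *\<^sub>C x + c *\<^sub>C y" by (rule c0_eqI) (simp add: scaleC_add_right)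
  show "(c + d) *\<^sub>C x = c *\<^sub>C x + d *\<^sub>C x" by (rule c0_eqI) (simp add: scaleC_add_left)
  show "c *\<^sub>C d *\<^sub>C x = (c * d) *\<^sub>C x" by (rule c0_eqI) (simp add: scaleC_scaleC)
  show "a *\<^sub>R x = complex_of_real a *\<^sub>C x" by (rule c0_eqI) (simp add: scaleR_scaleC)
  show "norm (c *\<^sub>C x) = norm c * norm x" by (simp add: norm_c0_def norm_scaleC)
qed

end


section \<open>The algebra of bounded holomorphic functions on the unit ball of \<open>c\<^sub>0\<close>\<close>

text \<open>
  A function on the open unit ball is represented by its extension by \<open>0\<close>, so that equality in
  the algebra is equality of HOL functions and the algebra operations are pointwise.
\<close>

definition Hinf :: "(c0 \<Rightarrow> complex) set" where
  "Hinf = {f. f fholomorphic_on ball 0 1 \<and> bounded (f ` ball 0 1) \<and> (\<forall>x. x \<notin> ball 0 1 \<longrightarrow> f x = 0)}"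

definition Hinf_norm :: "(c0 \<Rightarrow> complex) \<Rightarrow> real" where
  "Hinf_norm f = (SUP x\<in>ball 0 1. norm (f x))"

text \<open>Elements of the spectrum are \<open>undefined\<close> off \<open>Hinf\<close>, so they too are equal as HOL
  functions iff they agree on \<open>Hinf\<close>.\<close>

definition spectrum_Hinf :: "((c0 \<Rightarrow> complex) \<Rightarrow> complex) set" where
  "spectrum_Hinf = {\<phi> \<in> extensional Hinf.
     (\<forall>f\<in>Hinf. \<forall>g\<in>Hinf. \<phi> (\<lambda>x. f x + g x) = \<phi> f + \<phi> g) \<and>
     (\<forall>c. \<forall>f\<in>Hinf. \<phi> (\<lambda>x. c * f x) = c * \<phi> f) \<and>
     (\<forall>f\<in>Hinf. \<forall>g\<in>Hinf. \<phi> (\<lambda>x. f x * g x) = \<phi> f * \<phi> g) \<and>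
     (\<exists>f\<in>Hinf. \<phi> f \<noteq> 0)}"

definition ell1 :: "(nat \<Rightarrow> complex) set" where
  "ell1 = {a. summable (\<lambda>n. norm (a n))}"

definition ell1_on_ball :: "(nat \<Rightarrow> complex) \<Rightarrow> c0 \<Rightarrow> complex" where
  "ell1_on_ball a x = (if x \<in> ball 0 1 then (\<Sum>n. a n * c0_nth x n) else 0)"

text \<open>The fiber \<open>\<pi>\<^sup>-\<^sup>1(z)\<close>: the restriction of \<open>\<phi>\<close> to \<open>\<ell>\<^sub>1\<close> is \<open>z\<close>, acting on \<open>\<ell>\<^sub>1\<close> through the
  duality \<open>\<ell>\<^sub>1\<^sup>* = \<ell>\<^sub>\<infinity>\<close>.\<close>

definition fiber :: "linf \<Rightarrow> ((c0 \<Rightarrow> complex) \<Rightarrow> complex) set" where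
  "fiber z = {\<phi> \<in> spectrum_Hinf.
     \<forall>a\<in>ell1. \<phi> (ell1_on_ball a) = (\<Sum>n. a n * apply_bcontfun z n)}"

definition c0_truncate :: "nat \<Rightarrow> linf \<Rightarrow> c0" where
  "c0_truncate n w = Abs_c0 (Bcontfun (\<lambda>k. if k < n then apply_bcontfun w k else 0))"

lemma c0_nth_truncate: "c0_nth (c0_truncate n w) k = (if k < n then apply_bcontfun w k else 0)"
proof -
  let ?t = "\<lambda>k. if k < n then apply_bcontfun w k else 0"
  have "norm (?t k) \<le> norm w" for k
    by (simp add: norm_bounded)
  then have "?t \<in> bcontfun"
    by (intro bcontfun_normI[where b = "norm w"]) (auto simp: continuous_on_discrete)
  then have *: "apply_bcontfun (Bcontfun ?t) = ?t"
    by (rule Bcontfun_inverse)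
  have "?t \<longlonglongrightarrow> 0"
    by (rule tendsto_eventually) (auto simp: eventually_sequentially intro!: exI[of _ n])
  then have "Rep_c0 (Abs_c0 (Bcontfun ?t)) = Bcontfun ?t"
    by (simp add: Abs_c0_inverse *)
  then show ?thesis
    by (simp add: c0_truncate_def *)
qed

definition canonical_ext :: "(c0 \<Rightarrow> complex) \<Rightarrow> linf \<Rightarrow> complex" where
  "canonical_ext f w = lim (\<lambda>n. f (c0_truncate n w))"

definition delta_at :: "linf \<Rightarrow> (c0 \<Rightarrow> complex) \<Rightarrow> complex" where
  "delta_at w = (\<lambda>f\<in>Hinf. canonical_ext f w)"


section \<open>The Gleason metric\<close>

definition dual_norm :: "((c0 \<Rightarrow> complex) \<Rightarrow> complex) \<Rightarrow> real" where
  "dual_norm L = (SUP f\<in>{f \<in> Hinf. Hinf_norm f \<le> 1}. norm (L f))"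

definition gleason_dist :: "((c0 \<Rightarrow> complex) \<Rightarrow> complex) \<Rightarrow> ((c0 \<Rightarrow> complex) \<Rightarrow> complex) \<Rightarrow> real" where
  "gleason_dist \<phi> \<psi> = dual_norm (\<lambda>f. \<phi> f - \<psi> f)"

definition gleason_part :: "((c0 \<Rightarrow> complex) \<Rightarrow> complex) \<Rightarrow> ((c0 \<Rightarrow> complex) \<Rightarrow> complex) set" where
  "gleason_part \<phi> = {\<psi> \<in> spectrum_Hinf. gleason_dist \<phi> \<psi> < 2}"

definition gleason_isometry :: "(linf \<Rightarrow> (c0 \<Rightarrow> complex) \<Rightarrow> complex) \<Rightarrow> bool" where
  "gleason_isometry F \<longleftrightarrow> F \<in> ball 0 1 \<rightarrow> spectrum_Hinf \<and>
     (\<forall>w\<in>ball 0 1. \<forall>v\<in>ball 0 1. gleason_dist (F w) (F v) = gleason_dist (delta_at w) (delta_at v))"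

definition analytic_into_spectrum :: "(linf \<Rightarrow> (c0 \<Rightarrow> complex) \<Rightarrow> complex) \<Rightarrow> bool" where
  "analytic_into_spectrum F \<longleftrightarrow> F \<in> ball 0 1 \<rightarrow> spectrum_Hinf \<and>
     (\<forall>f\<in>Hinf. (\<lambda>w. F w f) fholomorphic_on ball 0 1)"

definition in_different_gleason_parts ::
    "((c0 \<Rightarrow> complex) \<Rightarrow> complex) set \<Rightarrow> ((c0 \<Rightarrow> complex) \<Rightarrow> complex) set \<Rightarrow> bool" where
  "in_different_gleason_parts A B \<longleftrightarrow>
     (\<forall>\<phi>\<in>A. \<forall>\<psi>\<in>B. \<psi> \<notin> gleason_part \<phi> \<and> \<phi> \<notin> gleason_part \<psi>)"


section \<open>The Stone-Cech compactification\<close>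

text \<open>
  The usual construction: the closure of the image of \<open>X\<close> under the evaluation map into the
  cube \<open>[0,1]\<^sup>C\<close>, where \<open>C\<close> is the set of continuous functions from \<open>X\<close> to \<open>[0,1]\<close>.
\<close>

definition unit_maps :: "'a topology \<Rightarrow> ('a \<Rightarrow> real) set" where
  "unit_maps X = {f \<in> extensional (topspace X). continuous_map X (top_of_set {0..1}) f}"

definition stone_cech_embed :: "'a topology \<Rightarrow> 'a \<Rightarrow> ('a \<Rightarrow> real) \<Rightarrow> real" where
  "stone_cech_embed X x = (\<lambda>f\<in>unit_maps X. f x)"

definition stone_cech :: "'a topology \<Rightarrow> (('a \<Rightarrow> real) \<Rightarrow> real) topology" where
  "stone_cech X =
     (let cube = product_topology (\<lambda>f. top_of_set {0..1::real}) (unit_maps X)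
      in subtopology cube (cube closure_of (stone_cech_embed X ` topspace X)))"

definition beta_nat_minus_nat :: "((nat \<Rightarrow> real) \<Rightarrow> real) set" where
  "beta_nat_minus_nat =
     topspace (stone_cech (discrete_topology UNIV)) -
     range (stone_cech_embed (discrete_topology UNIV))"

end

theory Submission
  imports Defs "HOL-Complex_Analysis.Cauchy_Integral_Formula"
begin

text \<open>
  Points of the fiber over \<open>z\<close> are obtained as limits, along the ultrafilter \<open>\<eta>\<close>, of evaluations at
  points \<open>p\<^sub>i(w)\<close> of the ball of \<open>c\<^sub>0\<close>. Let \<open>h\<^sub>r(u) = (r - u) / (1 - r u)\<close>, an involution of the disc,
  and let \<open>r\<^sub>i \<rightarrow> 1\<close> so fast that \<open>\<Sum> (1 - r\<^sub>i)\<close> converges. Coordinates are indexed by pairs; the pairs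
  \<open>(i, k)\<close> with fixed \<open>i\<close> form the \<open>i\<close>-th block. The finitely supported point \<open>p\<^sub>i(w)\<close> has the entry
  \<open>\<theta> h\<^sub>r\<^sub>i(w\<^sub>k)\<close> at \<open>(i, k)\<close> for \<open>k < i\<close>, where \<open>\<theta>\<close> is the unimodular direction opposite to the entry
  of \<open>z\<close> there, and the entry \<open>r\<^sub>i z\<^sub>j\<close> at each position \<open>j < i\<close>. Every coordinate of \<open>p\<^sub>i(w)\<close> tends
  to that of \<open>z\<close>, so the limit of the evaluations lies over \<open>z\<close>
  (\<open>fiber_embedding_in_fiber\<close>). It depends analytically on \<open>w\<close> since a pointwise limit of
  uniformly bounded holomorphic functions is holomorphic (\<open>hol_map_on_Lim\<close>).

  As \<open>f \<circ> p\<^sub>i\<close> is a bounded holomorphic function of finitely many coordinates, the embedding does not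
  increase Gleason distances (\<open>gleason_dist_fiber_embedding_le\<close>). For the converse one needs bounded
  functions that recover \<open>w\<close> from \<open>p\<^sub>i(w)\<close> for all large \<open>i\<close> at once. Linear functionals cannot
  do this: their coefficients are summable, so their values at \<open>p\<^sub>i(w)\<close> converge to a number that
  depends only on \<open>z\<close>. Products can. The function
  \<open>B\<^sub>k(x) = \<Prod>\<^sub>n h\<^sub>r\<^sub>n(\<theta>\<^sup>* x\<^sub>(\<^sub>n\<^sub>,\<^sub>k\<^sub>))\<close>, with \<open>\<theta>\<^sup>*\<close> the conjugate of \<open>\<theta>\<close> at \<open>(n, k)\<close>, is bounded by \<open>1\<close>.
  At \<open>p\<^sub>i(w)\<close> its \<open>i\<close>-th factor is \<open>h\<^sub>r\<^sub>i(h\<^sub>r\<^sub>i(w\<^sub>k)) = w\<^sub>k\<close>; in every other factor the argument of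
  \<open>h\<^sub>r\<^sub>n\<close> is a real number in \<open>[-1, 0]\<close>, by the choice of \<open>\<theta>\<close>, and there \<open>h\<^sub>r\<^sub>n\<close> differs from \<open>1\<close> by at
  most \<open>1 - r\<^sub>n\<close>. Hence the product over \<open>n \<ge> N\<close> equals \<open>w\<^sub>k\<close> up to \<open>\<Sum>\<^sub>n\<^sub>\<ge>\<^sub>N (1 - r\<^sub>n)\<close>
  (\<open>block_product_spread\<close>). Inserting these products for the first coordinates of \<open>f\<close> gives a test
  function whose value at the limit point is close to \<open>f(w\<^sub>0, \<dots>, w\<^sub>n, 0, \<dots>)\<close>, and as \<open>n\<close> grows
  this tends to the canonical extension of \<open>f\<close> at \<open>w\<close> (\<open>gleason_dist_fiber_embedding_ge\<close>).

  Distinct points \<open>\<eta>\<^sub>1\<close>, \<open>\<eta>\<^sub>2\<close> are separated by a set \<open>A\<close>. The product over \<open>n \<in> A\<close>, \<open>n \<ge> N\<close> is about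
  \<open>w\<^sub>0\<close> at the first limit point and about \<open>1\<close> at the second, where no factor is exceptional. Applying
  \<open>h\<^sub>a\<close> with \<open>a\<close> near \<open>1\<close> moves these values to \<open>1\<close> and \<open>-1\<close>, so the distance is \<open>2\<close>
  (\<open>gleason_dist_fiber_embedding_2\<close>).

  That \<open>f(w\<^sub>0, \<dots>, w\<^sub>n, 0, \<dots>)\<close> converges (\<open>Hinf_truncate_convergent\<close>) reduces to the homogeneous parts
  of \<open>f\<close>, and for those it is an induction on the degree, because \<open>P(b + x) - P(x)\<close> has smaller degree
  than \<open>P\<close>. The heart is that \<open>P\<close> tends to \<open>P(0)\<close> along far away blocks of \<open>w\<close>: otherwise \<open>P\<close> would grow
  by nearly the same nonzero amount each time a further block is added, although all sums of blocks
  stay in a fixed ball.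
\<close>

section \<open>Holomorphic maps between complex normed spaces\<close>

text \<open>
  On scalar functions this is \<open>fholomorphic_on\<close>. Other codomains occur because functions on the ball
  of \<open>c\<^sub>0\<close> get composed with holomorphic maps into that ball.
\<close>

definition hol_map_on ::
    "('a::complex_normed_vector \<Rightarrow> 'b::complex_normed_vector) \<Rightarrow> 'a set \<Rightarrow> bool" where
  "hol_map_on T S \<longleftrightarrow>
     (\<forall>x\<in>S. \<exists>D. (T has_derivative D) (at x) \<and> (\<forall>c h. D (c *\<^sub>C h) = c *\<^sub>C D h))"

lemma fholomorphic_on_iff_hol_map_on: "f fholomorphic_on S \<longleftrightarrow> hol_map_on f S"
  by (simp add: fholomorphic_on_def hol_map_on_def)

lemma bounded_bilinear_scaleC:
  "bounded_bilinear (scaleC :: complex \<Rightarrow> 'a::complex_normed_vector \<Rightarrow> 'a)"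
proof
  show "(a + a') *\<^sub>C b = a *\<^sub>C b + a' *\<^sub>C b" for a a' and b :: 'a
    by (rule scaleC_add_left)
  show "a *\<^sub>C (b + b') = a *\<^sub>C b + a *\<^sub>C b'" for a and b b' :: 'a
    by (rule scaleC_add_right)
  show "(r *\<^sub>R a) *\<^sub>C b = r *\<^sub>R (a *\<^sub>C b)" for r a and b :: 'a
    by (simp add: scaleR_scaleC[of r "a *\<^sub>C b"] scaleC_scaleC scaleR_conv_of_real)
  show "a *\<^sub>C (r *\<^sub>R b) = r *\<^sub>R (a *\<^sub>C b)" for r a and b :: 'a
    by (simp add: scaleR_scaleC scaleC_scaleC mult.commute)
  show "\<exists>K. \<forall>a b. norm (a *\<^sub>C b :: 'a) \<le> norm a * norm b * K"
    by (rule exI[of _ 1]) (simp add: norm_scaleC)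
qed

lemmas scaleC_zero_left [simp] = bounded_bilinear.zero_left[OF bounded_bilinear_scaleC]
lemmas scaleC_zero_right [simp] = bounded_bilinear.zero_right[OF bounded_bilinear_scaleC]

lemma scaleC_one [simp]: "1 *\<^sub>C (x :: 'a::complex_normed_vector) = x"
  using scaleR_scaleC[of 1 x] by simp

lemma hol_map_on_const: "hol_map_on (\<lambda>_. v) S"
  unfolding hol_map_on_def by (auto intro!: exI[of _ "\<lambda>_. 0"])

lemma hol_map_on_linear:
  assumes "bounded_linear L" "\<And>c x. L (c *\<^sub>C x) = c *\<^sub>C L x"
  shows "hol_map_on L S"
  unfolding hol_map_on_def
  using bounded_linear_imp_has_derivative[OF assms(1)] assms(2) by blast

lemma hol_map_on_add:
  assumes "hol_map_on T S" "hol_map_on U S"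
  shows "hol_map_on (\<lambda>x. T x + U x) S"
  unfolding hol_map_on_def
proof
  fix x assume "x \<in> S"
  then obtain D E where "(T has_derivative D) (at x)" "(U has_derivative E) (at x)"
    and "\<forall>c h. D (c *\<^sub>C h) = c *\<^sub>C D h" "\<forall>c h. E (c *\<^sub>C h) = c *\<^sub>C E h"
    using assms unfolding hol_map_on_def by blast
  then show "\<exists>D. ((\<lambda>x. T x + U x) has_derivative D) (at x) \<and> (\<forall>c h. D (c *\<^sub>C h) = c *\<^sub>C D h)"
    by (intro exI[of _ "\<lambda>h. D h + E h"]) (auto intro: has_derivative_add simp: scaleC_add_right)
qed

lemma hol_map_on_sum:
  "(\<And>i. i \<in> I \<Longrightarrow> hol_map_on (T i) S) \<Longrightarrow> hol_map_on (\<lambda>x. \<Sum>i\<in>I. T i x) S"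
  by (induction I rule: infinite_finite_induct) (auto intro: hol_map_on_add hol_map_on_const)

lemma hol_map_on_scaleC:
  assumes "hol_map_on f S" "hol_map_on T S"
  shows "hol_map_on (\<lambda>x. f x *\<^sub>C T x) S"
  unfolding hol_map_on_def
proof
  fix x assume "x \<in> S"
  then obtain D E where d: "(f has_derivative D) (at x)" "(T has_derivative E) (at x)"
    and l: "\<And>c h. D (c *\<^sub>C h) = c *\<^sub>C D h" "\<And>c h. E (c *\<^sub>C h) = c *\<^sub>C E h"
    using assms unfolding hol_map_on_def by blast
  have "f x *\<^sub>C E (c *\<^sub>C h) + D (c *\<^sub>C h) *\<^sub>C T x = c *\<^sub>C (f x *\<^sub>C E h + D h *\<^sub>C T x)" for c h
    by (simp add: l scaleC_add_right scaleC_scaleC mult.commute)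
  then show "\<exists>D. ((\<lambda>x. f x *\<^sub>C T x) has_derivative D) (at x) \<and> (\<forall>c h. D (c *\<^sub>C h) = c *\<^sub>C D h)"
    using bounded_bilinear.FDERIV[OF bounded_bilinear_scaleC d] by blast
qed

lemma hol_map_on_mult:
  "hol_map_on f S \<Longrightarrow> hol_map_on g S \<Longrightarrow> hol_map_on (\<lambda>x. f x * g x :: complex) S"
  using hol_map_on_scaleC[of f S g] by simp

lemma hol_map_on_prod:
  "(\<And>i. i \<in> I \<Longrightarrow> hol_map_on (T i) S) \<Longrightarrow> hol_map_on (\<lambda>x. \<Prod>i\<in>I. T i x :: complex) S"
  by (induction I rule: infinite_finite_induct) (auto intro: hol_map_on_mult hol_map_on_const)

lemma hol_map_on_compose:
  assumes "hol_map_on T S" "hol_map_on U R" "\<And>x. x \<in> S \<Longrightarrow> T x \<in> R"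
  shows "hol_map_on (\<lambda>x. U (T x)) S"
  unfolding hol_map_on_def
proof
  fix x assume x: "x \<in> S"
  then obtain D where D: "(T has_derivative D) (at x)" "\<And>c h. D (c *\<^sub>C h) = c *\<^sub>C D h"
    using assms unfolding hol_map_on_def by blast
  obtain E where E: "(U has_derivative E) (at (T x))" "\<And>c h. E (c *\<^sub>C h) = c *\<^sub>C E h"
    using assms x unfolding hol_map_on_def by blast
  show "\<exists>D. ((\<lambda>x. U (T x)) has_derivative D) (at x) \<and> (\<forall>c h. D (c *\<^sub>C h) = c *\<^sub>C D h)"
    using has_derivative_compose[OF D(1) E(1)]
    by (intro exI[of _ "\<lambda>h. E (D h)"]) (simp add: D E)
qed

lemma hol_map_on_cong:
  assumes "hol_map_on T S" "open S" "\<And>x. x \<in> S \<Longrightarrow> T x = U x"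
  shows "hol_map_on U S"
  using assms unfolding hol_map_on_def
  by (meson has_derivative_transform_within_open)

lemma hol_map_on_imp_continuous: "hol_map_on T S \<Longrightarrow> x \<in> S \<Longrightarrow> isCont T x"
  unfolding hol_map_on_def using has_derivative_continuous by blast

lemma holomorphic_on_imp_hol_map_on:
  assumes "f holomorphic_on U" "open U"
  shows "hol_map_on f U"
  unfolding hol_map_on_def
proof
  fix x assume "x \<in> U"
  then obtain f' where "(f has_field_derivative f') (at x)"
    using assms by (meson holomorphic_on_imp_differentiable_at field_differentiable_def)
  then show "\<exists>D. (f has_derivative D) (at x) \<and> (\<forall>c h. D (c *\<^sub>C h) = c *\<^sub>C D h)"
    unfolding has_field_derivative_def by (intro exI[of _ "(*) f'"]) auto
qed

lemma has_field_derivative_along_line: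
  assumes "(f has_derivative D) (at (x + \<zeta> *\<^sub>C h))" "\<And>c h. D (c *\<^sub>C h) = c * D h"
  shows "((\<lambda>\<zeta>. f (x + \<zeta> *\<^sub>C h)) has_field_derivative D h) (at \<zeta>)"
proof -
  have d: "((\<lambda>\<zeta>. x + \<zeta> *\<^sub>C h) has_derivative (\<lambda>\<zeta>. 0 + \<zeta> *\<^sub>C h)) (at \<zeta>)"
    by (intro has_derivative_add has_derivative_const bounded_linear_imp_has_derivative
        bounded_bilinear.bounded_linear_left[OF bounded_bilinear_scaleC])
  have "(*) (D h) = (\<lambda>\<zeta>. \<zeta> * D h)" by (simp add: fun_eq_iff)
  then show ?thesis
    using has_derivative_compose[OF d assms(1)]
    unfolding has_field_derivative_def by (simp add: assms(2))
qed

lemma holomorphic_along_line: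
  assumes "hol_map_on (f :: _ \<Rightarrow> complex) S"
  shows "(\<lambda>\<zeta>. f (x + \<zeta> *\<^sub>C h)) holomorphic_on {\<zeta>. x + \<zeta> *\<^sub>C h \<in> S}"
  unfolding holomorphic_on_def
proof
  fix \<zeta> assume "\<zeta> \<in> {\<zeta>. x + \<zeta> *\<^sub>C h \<in> S}"
  then obtain D where "(f has_derivative D) (at (x + \<zeta> *\<^sub>C h))" "\<And>c h. D (c *\<^sub>C h) = c * D h"
    using assms unfolding hol_map_on_def by fastforce
  from has_field_derivative_along_line[OF this]
  show "(\<lambda>\<zeta>. f (x + \<zeta> *\<^sub>C h)) field_differentiable at \<zeta> within {\<zeta>. x + \<zeta> *\<^sub>C h \<in> S}"
    by (meson field_differentiable_at_within field_differentiable_def)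
qed

section \<open>Taylor polynomials of a bounded holomorphic function on a disc\<close>

lemma Taylor_coeff_bound:
  assumes hol: "\<phi> holomorphic_on ball 0 R" and bd: "\<And>\<zeta>. \<zeta> \<in> ball 0 R \<Longrightarrow> norm (\<phi> \<zeta>) \<le> M"
    and R: "0 < R"
  shows "norm ((deriv ^^ n) \<phi> 0 / fact n) \<le> M / R ^ n"
proof -
  let ?a = "norm ((deriv ^^ n) \<phi> 0 / fact n)"
  have "?a * r ^ n \<le> M" if r: "0 < r" "r < R" for r
  proof -
    have sub: "cball 0 r \<subseteq> ball (0::complex) R" using r by auto
    have "norm ((deriv ^^ n) \<phi> 0) \<le> fact n * M / r ^ n"
    proof (rule Cauchy_inequality)
      show "\<phi> holomorphic_on ball 0 r" using hol r by (rule_tac holomorphic_on_subset) auto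
      show "continuous_on (cball 0 r) \<phi>"
        using hol sub holomorphic_on_imp_continuous_on continuous_on_subset by blast
    qed (use r bd in auto)
    then have "?a \<le> M / r ^ n" by (simp add: norm_divide pos_divide_le_eq mult_ac)
    then show ?thesis using r by (simp add: pos_le_divide_eq)
  qed
  then have "\<forall>\<^sub>F r in at_left R. ?a * r ^ n \<le> M"
    by (intro eventually_mono[OF eventually_at_left_real[OF R]]) auto
  moreover have "((\<lambda>r. ?a * r ^ n) \<longlongrightarrow> ?a * R ^ n) (at_left R)"
    by (intro tendsto_intros)
  ultimately have "?a * R ^ n \<le> M"
    by (intro tendsto_upperbound[where F = "at_left R"]) auto
  then show ?thesis using R by (simp add: field_simps)
qed

text \<open>
  By the Cauchy estimates the remainder is dominated by the tail of a geometric series. The bound sees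
  \<open>\<phi>\<close> only through \<open>M\<close> and \<open>R\<close>, hence is uniform over families and over directions in a normed space.
\<close>

lemma Taylor_remainder_bound:
  assumes hol: "\<phi> holomorphic_on ball 0 R" and bd: "\<And>\<zeta>. \<zeta> \<in> ball 0 R \<Longrightarrow> norm (\<phi> \<zeta>) \<le> M"
    and \<zeta>: "norm \<zeta> < R"
  shows "norm (\<phi> \<zeta> - (\<Sum>m<N. (deriv ^^ m) \<phi> 0 / fact m * \<zeta> ^ m))
    \<le> M * (norm \<zeta> / R) ^ N / (1 - norm \<zeta> / R)"
proof -
  define a where "a m = (deriv ^^ m) \<phi> 0 / fact m" for m
  define q where "q = norm \<zeta> / R"
  have R: "0 < R" using \<zeta> norm_ge_zero[of \<zeta>] by linarith
  have q: "0 \<le> q" "q < 1" using \<zeta> R by (auto simp: q_def)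
  have s: "(\<lambda>m. a m * \<zeta> ^ m) sums \<phi> \<zeta>"
    using holomorphic_power_series[OF hol, of \<zeta>] \<zeta> by (simp add: a_def)
  have b: "norm (a m * \<zeta> ^ m) \<le> M * q ^ m" for m
    using mult_right_mono[OF Taylor_coeff_bound[OF hol bd R, of m], of "norm \<zeta> ^ m"]
    by (simp add: norm_mult norm_divide norm_power a_def q_def power_divide)
  have g: "(\<lambda>m. M * q ^ (m + N)) sums (M * q ^ N / (1 - q))"
    using sums_mult[OF geometric_sums[of q], of "M * q ^ N"] q by (simp add: power_add mult_ac)
  have s': "(\<lambda>m. a (m + N) * \<zeta> ^ (m + N)) sums (\<phi> \<zeta> - (\<Sum>m<N. a m * \<zeta> ^ m))"
    using sums_split_initial_segment[OF s] .
  have "norm (\<Sum>m. a (m + N) * \<zeta> ^ (m + N)) \<le> (\<Sum>m. M * q ^ (m + N))"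
    using b g by (intro norm_suminf_le) (auto simp: sums_iff)
  then show ?thesis using g s' by (simp add: sums_iff a_def q_def)
qed

section \<open>Limits of bounded sequences along a free ultrafilter\<close>

text \<open>
  All that is used of a free ultrafilter on \<open>\<nat>\<close>.
\<close>

definition free_limit_filter :: "nat filter \<Rightarrow> bool" where
  "free_limit_filter F \<longleftrightarrow> F \<noteq> bot \<and> F \<le> sequentially \<and>
     (\<forall>a :: nat \<Rightarrow> complex. bounded (range a) \<longrightarrow> (\<exists>L. (a \<longlongrightarrow> L) F))"

lemma free_limit_filter_neq_bot: "free_limit_filter F \<Longrightarrow> F \<noteq> bot"
  unfolding free_limit_filter_def by (rule conjunct1)

lemma eventually_ge_free_limit_filter:
  "free_limit_filter F \<Longrightarrow> \<forall>\<^sub>F i in F. N \<le> i"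
  unfolding free_limit_filter_def by (rule filter_leD[OF _ eventually_ge_at_top]) blast

lemma Lim_tendsto:
  fixes a :: "nat \<Rightarrow> complex"
  assumes "free_limit_filter F" "\<And>n. norm (a n) \<le> M"
  shows "(a \<longlongrightarrow> Lim F a) F"
proof -
  have "bounded (range a)" using assms(2) by (auto intro: boundedI)
  then obtain L where "(a \<longlongrightarrow> L) F" using assms(1) by (auto simp: free_limit_filter_def)
  moreover have "F \<noteq> bot" using assms(1) by (simp add: free_limit_filter_def)
  ultimately show ?thesis using tendsto_Lim by metis
qed

text \<open>
  On each complex line through \<open>x\<close> the first two Taylor coefficients are bounded by \<open>M\<close>, and the
  remainder after the linear term is at most a constant times \<open>(norm h)\<^sup>2\<close>, the same constant for all
  \<open>n\<close>. Both estimates survive the limit, so the limits of the derivatives at \<open>x\<close> form a derivative of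
  the limit function.
\<close>

lemma hol_map_on_Lim:
  fixes g :: "nat \<Rightarrow> 'a::complex_normed_vector \<Rightarrow> complex"
  assumes F: "free_limit_filter F" and S: "open S"
    and hol: "\<And>n. hol_map_on (g n) S" and bd: "\<And>n x. x \<in> S \<Longrightarrow> norm (g n x) \<le> M"
  shows "hol_map_on (\<lambda>x. Lim F (\<lambda>n. g n x)) S"
  unfolding hol_map_on_def
proof
  fix x assume x: "x \<in> S"
  have nb: "F \<noteq> bot" using F by (simp add: free_limit_filter_def)
  obtain \<delta> where \<delta>: "\<delta> > 0" "ball x \<delta> \<subseteq> S" using S x open_contains_ball by blast
  have M: "0 \<le> M" using bd[OF x, of 0] norm_ge_zero order_trans by blast
  have "\<forall>n. \<exists>D. (g n has_derivative D) (at x) \<and> (\<forall>c h. D (c *\<^sub>C h) = c * D h)"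
    using hol x by (simp add: hol_map_on_def)
  from choice[OF this] obtain D where D: "\<And>n. (g n has_derivative D n) (at x)"
    and lin: "\<And>n c h. D n (c *\<^sub>C h) = c * D n h"
    by blast
  note bl = has_derivative_bounded_linear[OF D]
  have disc: "(\<lambda>\<zeta>. g n (x + \<zeta> *\<^sub>C h)) holomorphic_on ball 0 (\<delta> / norm h)"
      "\<And>\<zeta>. \<zeta> \<in> ball 0 (\<delta> / norm h) \<Longrightarrow> norm (g n (x + \<zeta> *\<^sub>C h)) \<le> M"
      "deriv (\<lambda>\<zeta>. g n (x + \<zeta> *\<^sub>C h)) 0 = D n h" if "h \<noteq> 0" for n h
  proof -
    have mem: "x + \<zeta> *\<^sub>C h \<in> S" if "\<zeta> \<in> ball 0 (\<delta> / norm h)" for \<zeta>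
    proof -
      have "x + \<zeta> *\<^sub>C h \<in> ball x \<delta>"
        using that \<open>h \<noteq> 0\<close> by (simp add: dist_norm norm_scaleC field_simps)
      then show ?thesis using \<delta> by blast
    qed
    show "(\<lambda>\<zeta>. g n (x + \<zeta> *\<^sub>C h)) holomorphic_on ball 0 (\<delta> / norm h)"
      using holomorphic_along_line[OF hol[of n], of x h] mem
      by (rule_tac holomorphic_on_subset) auto
    show "norm (g n (x + \<zeta> *\<^sub>C h)) \<le> M" if "\<zeta> \<in> ball 0 (\<delta> / norm h)" for \<zeta>
      using bd mem that by blast
    show "deriv (\<lambda>\<zeta>. g n (x + \<zeta> *\<^sub>C h)) 0 = D n h"
      using has_field_derivative_along_line[of "g n" "D n" x 0 h] D lin
      by (intro DERIV_imp_deriv) auto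
  qed
  have Dbd: "norm (D n h) \<le> norm h * (M / \<delta>)" for n h
  proof (cases "h = 0")
    case True
    then show ?thesis using bounded_linear.linear[OF bl] by (simp add: linear_0)
  next
    case False
    show ?thesis
      using Taylor_coeff_bound[OF disc(1,2)[OF False], of 1 n] disc(3)[OF False] \<delta> False
      by (simp add: field_simps)
  qed
  define E where "E h = Lim F (\<lambda>n. D n h)" for h
  have E: "((\<lambda>n. D n h) \<longlongrightarrow> E h) F" for h
    unfolding E_def using Lim_tendsto[OF F Dbd] .
  have G: "((\<lambda>n. g n y) \<longlongrightarrow> Lim F (\<lambda>n. g n y)) F" if "y \<in> S" for y
    using Lim_tendsto[OF F bd[OF that]] .
  have EC: "E (c *\<^sub>C h) = c * E h" for c h
    using tendsto_mult[OF tendsto_const[of c] E[of h]] E[of "c *\<^sub>C h"] tendsto_unique[OF nb]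
    by (simp add: lin)
  have "bounded_linear E"
  proof
    show "E (h + k) = E h + E k" for h k
      using tendsto_add[OF E[of h] E[of k]] E[of "h + k"] tendsto_unique[OF nb]
      by (simp add: linear_add[OF bounded_linear.linear[OF bl]])
    show "E (r *\<^sub>R h) = r *\<^sub>R E h" for r h
      using EC[of "of_real r" h] by (simp add: scaleR_scaleC)
    have "norm (E h) \<le> norm h * (M / \<delta>)" for h
      by (rule tendsto_upperbound[OF tendsto_norm[OF E] _ nb])
        (rule always_eventually, rule allI, rule Dbd)
    then show "\<exists>K. \<forall>h. norm (E h) \<le> norm h * K" by blast
  qed
  moreover have rem: "norm (Lim F (\<lambda>n. g n (x + h)) - Lim F (\<lambda>n. g n x) - E h)
      \<le> 2 * M / \<delta>\<^sup>2 * norm h * norm h" if h: "norm h < \<delta> / 2" for h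
  proof (cases "h = 0")
    case True
    then show ?thesis using EC[of 0 0] by simp
  next
    case False
    have "x + h \<in> ball x \<delta>" using h \<delta>(1) by (simp add: dist_norm)
    then have mem: "x + h \<in> S" using \<delta> by blast
    have R: "2 < \<delta> / norm h" using h False by (simp add: field_simps)
    have "norm (g n (x + h) - g n x - D n h) \<le> 2 * M / \<delta>\<^sup>2 * norm h * norm h" for n
    proof -
      have "norm (g n (x + h) - g n x - D n h)
          \<le> M * (1 / (\<delta> / norm h)) ^ 2 / (1 - 1 / (\<delta> / norm h))"
        using Taylor_remainder_bound[OF disc(1,2)[OF False], of 1 n 2] disc(3)[OF False] R
        by (simp add: numeral_2_eq_2 diff_diff_eq)
      also have "\<dots> \<le> M * (1 / (\<delta> / norm h)) ^ 2 / (1 / 2)"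
        using R M \<delta>(1) False
        by (intro divide_left_mono mult_nonneg_nonneg mult_pos_pos) (simp_all add: field_simps)
      finally show ?thesis by (simp add: power2_eq_square field_simps)
    qed
    then show ?thesis
      by (intro tendsto_upperbound[OF tendsto_norm[OF tendsto_diff[OF tendsto_diff[OF
              G[OF mem] G[OF x]] E]] _ nb]) simp
  qed
  have "((\<lambda>x. Lim F (\<lambda>n. g n x)) has_derivative E) (at x)"
    unfolding has_derivative_at_alt
  proof (intro conjI allI impI)
    show "bounded_linear E" by fact
    fix e :: real assume e: "e > 0"
    define d where "d = min (\<delta> / 2) (e / (2 * M / \<delta>\<^sup>2 + 1))"
    have K: "0 \<le> 2 * M / \<delta>\<^sup>2" using M by simp
    have "d > 0" using e \<delta> K by (simp add: d_def add_nonneg_pos)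
    moreover have "norm (Lim F (\<lambda>n. g n y) - Lim F (\<lambda>n. g n x) - E (y - x)) \<le> e * norm (y - x)"
      if y: "norm (y - x) < d" for y
    proof -
      have "norm (Lim F (\<lambda>n. g n y) - Lim F (\<lambda>n. g n x) - E (y - x))
          \<le> 2 * M / \<delta>\<^sup>2 * norm (y - x) * norm (y - x)"
        using rem[of "y - x"] y by (simp add: d_def)
      also have "2 * M / \<delta>\<^sup>2 * norm (y - x) \<le> (2 * M / \<delta>\<^sup>2 + 1) * norm (y - x)"
        by (intro mult_right_mono) auto
      also have "\<dots> \<le> (2 * M / \<delta>\<^sup>2 + 1) * (e / (2 * M / \<delta>\<^sup>2 + 1))"
        using y K by (intro mult_left_mono) (auto simp: d_def)
      also have "\<dots> = e" using K by simp
      finally show ?thesis by (simp add: mult_right_mono)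
    qed
    ultimately show "\<exists>d>0. \<forall>y. norm (y - x) < d \<longrightarrow>
        norm (Lim F (\<lambda>n. g n y) - Lim F (\<lambda>n. g n x) - E (y - x)) \<le> e * norm (y - x)" by blast
  qed
  then show "\<exists>D. ((\<lambda>x. Lim F (\<lambda>n. g n x)) has_derivative D) (at x) \<and>
      (\<forall>c h. D (c *\<^sub>C h) = c *\<^sub>C D h)"
    using EC by auto
qed

section \<open>Points of the Stone-Cech remainder as free limit filters\<close>

abbreviation nat_unit_maps :: "(nat \<Rightarrow> real) set" where
  "nat_unit_maps \<equiv> unit_maps (discrete_topology UNIV)"

abbreviation nat_embed :: "nat \<Rightarrow> (nat \<Rightarrow> real) \<Rightarrow> real" where
  "nat_embed \<equiv> stone_cech_embed (discrete_topology UNIV)"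

text \<open>
  The trace on \<open>\<nat>\<close> of the neighbourhoods of \<open>\<eta>\<close> in the cube. Evaluation of \<open>\<eta>\<close> at a map \<open>f\<close> into
  \<open>[0, 1]\<close> then is the limit of \<open>f\<close> along this filter.
\<close>

definition remainder_filter :: "((nat \<Rightarrow> real) \<Rightarrow> real) \<Rightarrow> nat filter" where
  "remainder_filter \<eta> = (INF f\<in>nat_unit_maps. filtercomap f (nhds (\<eta> f)))"

lemma nat_unit_maps_iff: "f \<in> nat_unit_maps \<longleftrightarrow> range f \<subseteq> {0..1}"
  by (simp add: unit_maps_def continuous_map_def Pi_iff image_subset_iff)

lemma tendsto_remainder_filter:
  "f \<in> nat_unit_maps \<Longrightarrow> (f \<longlongrightarrow> \<eta> f) (remainder_filter \<eta>)"
  unfolding remainder_filter_def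
  by (meson INF_lower filterlim_filtercomap filterlim_mono order_refl)

lemma remainder_extensional:
  "\<eta> \<in> beta_nat_minus_nat \<Longrightarrow> \<eta> \<in> extensional nat_unit_maps"
  by (auto simp: beta_nat_minus_nat_def stone_cech_def Let_def PiE_def)

text \<open>
  A basic neighbourhood of \<open>\<eta>\<close> restricts finitely many coordinates, and it contains the image of some
  natural number because \<open>\<eta>\<close> lies in the closure of these images.
\<close>

lemma remainder_filter_neq_bot:
  assumes "\<eta> \<in> beta_nat_minus_nat"
  shows "remainder_filter \<eta> \<noteq> bot"
proof -
  let ?cube = "product_topology (\<lambda>f. top_of_set {0..1::real}) nat_unit_maps"
  have cl: "\<eta> \<in> ?cube closure_of (range nat_embed)"
    using assms by (simp add: beta_nat_minus_nat_def stone_cech_def Let_def)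
  have "\<exists>n. P n" if ev: "eventually P (remainder_filter \<eta>)" for P
  proof -
    obtain X where X: "finite X" "X \<subseteq> nat_unit_maps"
      and evX: "eventually P (INF f\<in>X. filtercomap f (nhds (\<eta> f)))"
      using iffD1[OF eventually_INF ev[unfolded remainder_filter_def]] by blast
    obtain Q where Q: "\<And>f. f \<in> X \<Longrightarrow> eventually (Q f) (filtercomap f (nhds (\<eta> f)))"
      and QP: "\<And>n. (\<forall>f\<in>X. Q f n) \<Longrightarrow> P n"
      using iffD1[OF eventually_INF_finite[OF X(1)] evX] by blast
    have "\<forall>f\<in>X. \<exists>U. open U \<and> \<eta> f \<in> U \<and> (\<forall>n. f n \<in> U \<longrightarrow> Q f n)"
      using Q by (simp add: eventually_filtercomap_nhds)
    then obtain U where U: "\<And>f. f \<in> X \<Longrightarrow> open (U f) \<and> \<eta> f \<in> U f \<and> (\<forall>n. f n \<in> U f \<longrightarrow> Q f n)"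
      by metis
    define W where "W = (\<Pi>\<^sub>E f\<in>nat_unit_maps. if f \<in> X then {0..1} \<inter> U f else {0..1})"
    have "openin ?cube W"
      unfolding W_def openin_PiE_gen
    proof (intro disjI2 conjI ballI)
      have "{f \<in> nat_unit_maps. (if f \<in> X then {0..1} \<inter> U f else {0..1})
          \<noteq> topspace (top_of_set {0..1::real})} \<subseteq> X" by auto
      then show "finite {f \<in> nat_unit_maps. (if f \<in> X then {0..1} \<inter> U f else {0..1})
          \<noteq> topspace (top_of_set {0..1::real})}"
        using X(1) finite_subset by blast
    qed (use U in \<open>auto simp: openin_open_Int\<close>)
    moreover have "\<eta> \<in> W"
    proof -
      have "\<eta> \<in> topspace ?cube"
        by (rule subsetD[OF closure_of_subset_topspace cl])
      then show ?thesis using U by (auto simp: W_def PiE_iff)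
    qed
    ultimately obtain n where n: "nat_embed n \<in> W"
      using cl unfolding in_closure_of by blast
    have "f n \<in> U f" if "f \<in> X" for f
      using n that X(2) by (force simp: W_def PiE_iff stone_cech_embed_def)
    then show ?thesis using QP U by blast
  qed
  then show ?thesis
    using eventually_bot[of "\<lambda>_. False"] by metis
qed

text \<open>
  The indicator function of \<open>{n}\<close> has a limit. If the limit is \<open>1\<close>, the filter is concentrated at \<open>n\<close>
  and \<open>\<eta>\<close> is the image of \<open>n\<close>; otherwise the filter eventually avoids \<open>n\<close>.
\<close>

lemma remainder_filter_free:
  assumes \<eta>: "\<eta> \<in> beta_nat_minus_nat"
  shows "remainder_filter \<eta> \<le> sequentially"
proof -
  have "\<forall>\<^sub>F k in remainder_filter \<eta>. k \<noteq> n" for n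
  proof -
    define f :: "nat \<Rightarrow> real" where "f = indicator {n}"
    have f: "f \<in> nat_unit_maps" by (auto simp: nat_unit_maps_iff f_def indicator_def)
    have "\<eta> f \<noteq> 1"
    proof
      assume 1: "\<eta> f = 1"
      have "\<forall>\<^sub>F k in remainder_filter \<eta>. f k > 1/2"
        using order_tendstoD(1)[OF tendsto_remainder_filter[OF f, of \<eta>], of "1/2"] 1 by simp
      then have k: "\<forall>\<^sub>F k in remainder_filter \<eta>. k = n"
        by eventually_elim (rule ccontr, simp add: f_def)
      have "\<eta> g = nat_embed n g" for g
      proof (cases "g \<in> nat_unit_maps")
        case True
        have "(g \<longlongrightarrow> g n) (remainder_filter \<eta>)"
          by (rule tendsto_eventually) (use k in eventually_elim, simp)
        then show ?thesis
          using tendsto_unique[OF remainder_filter_neq_bot[OF \<eta>] tendsto_remainder_filter[OF True]]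
            True by (simp add: stone_cech_embed_def)
      next
        case False
        then show ?thesis
          using remainder_extensional[OF \<eta>] by (simp add: stone_cech_embed_def extensional_def)
      qed
      then have "\<eta> = nat_embed n" by blast
      then show False using \<eta> by (auto simp: beta_nat_minus_nat_def)
    qed
    then have "\<forall>\<^sub>F k in remainder_filter \<eta>. f k \<noteq> 1"
      using tendsto_imp_eventually_ne[OF tendsto_remainder_filter[OF f]] by blast
    then show ?thesis by eventually_elim (auto simp: f_def)
  qed
  then have ev: "\<forall>\<^sub>F k in remainder_filter \<eta>. \<forall>n\<in>{..<N}. k \<noteq> n" for N
    by (intro eventually_ball_finite) auto
  have le: "N \<le> k" if "\<forall>n\<in>{..<N}. k \<noteq> n" for N k :: nat
    using that by (cases "k < N") auto
  have "\<forall>\<^sub>F k in remainder_filter \<eta>. N \<le> k" for N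
    using ev[of N] by (rule eventually_mono) (rule le)
  then have "filterlim (\<lambda>k. k) sequentially (remainder_filter \<eta>)"
    by (simp add: filterlim_at_top)
  then show ?thesis by (simp only: filterlim_def filtermap_ident)
qed

lemma remainder_filter_real_limit:
  assumes "\<eta> \<in> beta_nat_minus_nat" "\<And>n. \<bar>a n\<bar> \<le> (M::real)"
  shows "\<exists>L. (a \<longlongrightarrow> L) (remainder_filter \<eta>)"
proof -
  \<comment> \<open>Positive even if \<open>a\<close> vanishes, so that one may divide by it.\<close>
  define K where "K = M + 1"
  have K: "K > 0" "\<bar>a n\<bar> \<le> K" for n
    using assms(2)[of 0] assms(2)[of n] by (simp_all add: K_def)
  define f where "f n = (a n + K) / (2 * K)" for n
  have "f n \<in> {0..1}" for n
    using K(1) K(2)[of n] by (auto simp: f_def field_simps)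
  then have "f \<in> nat_unit_maps" by (auto simp: nat_unit_maps_iff)
  from tendsto_remainder_filter[OF this]
  have "((\<lambda>n. f n * (2 * K) - K) \<longlongrightarrow> \<eta> f * (2 * K) - K) (remainder_filter \<eta>)"
    by (intro tendsto_intros)
  moreover have "(\<lambda>n. f n * (2 * K) - K) = a" using K(1) by (auto simp: f_def)
  ultimately show ?thesis by auto
qed

lemma remainder_free_limit_filter:
  assumes \<eta>: "\<eta> \<in> beta_nat_minus_nat"
  shows "free_limit_filter (remainder_filter \<eta>)"
  unfolding free_limit_filter_def
proof (intro conjI allI impI)
  show "remainder_filter \<eta> \<noteq> bot" by (rule remainder_filter_neq_bot[OF \<eta>])
  show "remainder_filter \<eta> \<le> sequentially" by (rule remainder_filter_free[OF \<eta>])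
  fix a :: "nat \<Rightarrow> complex" assume "bounded (range a)"
  then obtain M where M: "\<And>n. norm (a n) \<le> M" by (auto simp: bounded_iff)
  obtain L1 where L1: "((\<lambda>n. Re (a n)) \<longlongrightarrow> L1) (remainder_filter \<eta>)"
    using remainder_filter_real_limit[OF \<eta>, of "\<lambda>n. Re (a n)"] order_trans[OF abs_Re_le_cmod M]
    by blast
  obtain L2 where L2: "((\<lambda>n. Im (a n)) \<longlongrightarrow> L2) (remainder_filter \<eta>)"
    using remainder_filter_real_limit[OF \<eta>, of "\<lambda>n. Im (a n)"] order_trans[OF abs_Im_le_cmod M]
    by blast
  from L1 L2 show "\<exists>L. (a \<longlongrightarrow> L) (remainder_filter \<eta>)"
    by (intro exI[of _ "Complex L1 L2"]) (simp add: tendsto_complex_iff)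
qed

lemma remainder_filters_separated:
  assumes \<eta>: "\<eta>\<^sub>1 \<in> beta_nat_minus_nat" "\<eta>\<^sub>2 \<in> beta_nat_minus_nat" "\<eta>\<^sub>1 \<noteq> \<eta>\<^sub>2"
  obtains A where "\<forall>\<^sub>F n in remainder_filter \<eta>\<^sub>1. n \<in> A" "\<forall>\<^sub>F n in remainder_filter \<eta>\<^sub>2. n \<notin> A"
proof -
  obtain f where f: "f \<in> nat_unit_maps" "\<eta>\<^sub>1 f \<noteq> \<eta>\<^sub>2 f"
    using \<eta> remainder_extensional extensionalityI by metis
  define c where "c = (\<eta>\<^sub>1 f + \<eta>\<^sub>2 f) / 2"
  note t1 = tendsto_remainder_filter[OF f(1), of \<eta>\<^sub>1]
  note t2 = tendsto_remainder_filter[OF f(1), of \<eta>\<^sub>2]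
  consider "\<eta>\<^sub>1 f < c" "c < \<eta>\<^sub>2 f" | "\<eta>\<^sub>2 f < c" "c < \<eta>\<^sub>1 f"
    using f(2) unfolding c_def by (cases "\<eta>\<^sub>1 f < \<eta>\<^sub>2 f") auto
  then show ?thesis
  proof cases
    case 1
    have "\<forall>\<^sub>F n in remainder_filter \<eta>\<^sub>1. f n < c" "\<forall>\<^sub>F n in remainder_filter \<eta>\<^sub>2. c < f n"
      using order_tendstoD(2)[OF t1 1(1)] order_tendstoD(1)[OF t2 1(2)] .
    then show ?thesis
      by (intro that[of "{n. f n < c}"]) (auto elim!: eventually_mono)
  next
    case 2
    have "\<forall>\<^sub>F n in remainder_filter \<eta>\<^sub>2. f n < c" "\<forall>\<^sub>F n in remainder_filter \<eta>\<^sub>1. c < f n"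
      using order_tendstoD(2)[OF t2 2(1)] order_tendstoD(1)[OF t1 2(2)] .
    then show ?thesis
      by (intro that[of "{n. c < f n}"]) (auto elim!: eventually_mono)
  qed
qed

section \<open>Finitely supported sequences\<close>

lemma norm_c0_nth_le: "norm (c0_nth x j) \<le> norm x"
  by (simp add: norm_c0_def norm_bounded)

lemma norm_c0_le: "(\<And>j. norm (c0_nth x j) \<le> b) \<Longrightarrow> norm x \<le> b"
  by (simp add: norm_c0_def norm_bound)

lemma c0_eq_nthI: "(\<And>j. c0_nth x j = c0_nth y j) \<Longrightarrow> x = y"
  by (intro c0_eqI bcontfun_eqI)

text \<open>
  Unit vectors are written with \<open>c0_truncate\<close>, whose coordinates are known, to stay away from the
  abstraction functions of the two types.
\<close>

definition c0_unit :: "nat \<Rightarrow> c0" where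
  "c0_unit k = c0_truncate (Suc k) (const_bcontfun 1) - c0_truncate k (const_bcontfun 1)"

definition c0_fin :: "nat set \<Rightarrow> (nat \<Rightarrow> complex) \<Rightarrow> c0" where
  "c0_fin K a = (\<Sum>k\<in>K. a k *\<^sub>C c0_unit k)"

lemma c0_nth_unit: "c0_nth (c0_unit k) j = (if j = k then 1 else 0)"
  by (auto simp: c0_unit_def minus_bcontfun.rep_eq c0_nth_truncate const_bcontfun.rep_eq)

lemma c0_nth_fin:
  assumes "finite K"
  shows "c0_nth (c0_fin K a) j = (if j \<in> K then a j else 0)"
  using assms unfolding c0_fin_def
  by (induction K) (auto simp: plus_bcontfun.rep_eq c0_nth_unit)

lemma norm_c0_fin_le:
  assumes "finite K" "\<And>k. k \<in> K \<Longrightarrow> norm (a k) \<le> b" "0 \<le> b"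
  shows "norm (c0_fin K a) \<le> b"
  by (rule norm_c0_le) (use assms in \<open>simp add: c0_nth_fin\<close>)

lemma norm_c0_fin_less_1:
  assumes "finite K" "\<And>k. k \<in> K \<Longrightarrow> norm (a k) < 1"
  shows "norm (c0_fin K a) < 1"
proof -
  let ?b = "Max (insert 0 ((\<lambda>k. norm (a k)) ` K))"
  have "norm (c0_fin K a) \<le> ?b"
    by (rule norm_c0_fin_le) (use assms in auto)
  also have "?b < 1" using assms by auto
  finally show ?thesis .
qed

lemma hol_map_on_c0_fin:
  "(\<And>k. k \<in> K \<Longrightarrow> hol_map_on (\<lambda>x. a x k) S) \<Longrightarrow> hol_map_on (\<lambda>x. c0_fin K (a x)) S"
  unfolding c0_fin_def by (intro hol_map_on_sum hol_map_on_scaleC hol_map_on_const) auto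

lemma c0_truncate_eq_fin: "c0_truncate n w = c0_fin {..<n} (apply_bcontfun w)"
  by (rule c0_eq_nthI) (simp add: c0_nth_fin c0_nth_truncate)

lemma norm_c0_truncate_le: "norm (c0_truncate n w) \<le> norm w"
  by (simp add: c0_truncate_eq_fin norm_c0_fin_le norm_bounded)

lemma hol_map_on_nth: "hol_map_on (\<lambda>w :: linf. apply_bcontfun w k) S"
proof (rule hol_map_on_linear)
  show "bounded_linear (\<lambda>w :: linf. apply_bcontfun w k)"
  proof
    show "\<exists>K. \<forall>w :: linf. norm (apply_bcontfun w k) \<le> norm w * K"
      by (rule exI[of _ 1]) (simp add: norm_bounded)
  qed (simp_all add: plus_bcontfun.rep_eq)
qed simp

lemma hol_map_on_c0_nth: "hol_map_on (\<lambda>x. c0_nth x k) S"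
proof (rule hol_map_on_linear)
  show "bounded_linear (\<lambda>x. c0_nth x k)"
  proof
    show "\<exists>K. \<forall>x. norm (c0_nth x k) \<le> norm x * K"
      by (rule exI[of _ 1]) (simp add: norm_c0_nth_le)
  qed (simp_all add: plus_bcontfun.rep_eq)
qed simp

lemma hol_map_on_Rep_c0: "hol_map_on Rep_c0 S"
proof (rule hol_map_on_linear)
  show "bounded_linear Rep_c0"
    by standard (auto simp: norm_c0_def intro: exI[of _ 1])
qed simp

section \<open>The algebra of bounded holomorphic functions\<close>

lemma Hinf_hol_map_on: "f \<in> Hinf \<Longrightarrow> hol_map_on f (ball 0 1)"
  by (simp add: Hinf_def fholomorphic_on_iff_hol_map_on)

lemma norm_le_Hinf_norm:
  assumes f: "f \<in> Hinf"
  shows "norm (f x) \<le> Hinf_norm f"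
proof -
  have bdd: "bdd_above ((\<lambda>x. norm (f x)) ` ball 0 1)"
    using f by (auto simp: Hinf_def bounded_iff bdd_above_def)
  have up: "norm (f x) \<le> Hinf_norm f" if "x \<in> ball 0 1" for x
    unfolding Hinf_norm_def by (rule cSUP_upper[OF that bdd])
  show ?thesis
  proof (cases "x \<in> ball 0 1")
    case False
    then have "f x = 0" using f by (simp add: Hinf_def)
    then show ?thesis using order_trans[OF norm_ge_zero up[of 0]] by simp
  qed (rule up)
qed

lemma Hinf_norm_le: "(\<And>x. norm x < 1 \<Longrightarrow> norm (f x) \<le> M) \<Longrightarrow> Hinf_norm f \<le> M"
  unfolding Hinf_norm_def by (rule cSUP_least) auto

lemma Hinf_eq_0: "f \<in> Hinf \<Longrightarrow> x \<notin> ball 0 1 \<Longrightarrow> f x = 0"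
  by (simp add: Hinf_def)

lemma HinfI:
  assumes "hol_map_on f (ball 0 1)" "\<And>x. norm x < 1 \<Longrightarrow> norm (f x) \<le> M"
    "\<And>x. x \<notin> ball 0 1 \<Longrightarrow> f x = 0"
  shows "f \<in> Hinf"
  using assms by (auto simp: Hinf_def fholomorphic_on_iff_hol_map_on intro!: boundedI[of _ M])

lemma Hinf_restrictI:
  assumes hol: "hol_map_on f (ball 0 1)" and bd: "\<And>x. norm x < 1 \<Longrightarrow> norm (f x) \<le> M"
  shows "(\<lambda>x. if x \<in> ball 0 1 then f x else 0) \<in> Hinf"
proof (rule HinfI)
  show "hol_map_on (\<lambda>x. if x \<in> ball 0 1 then f x else 0) (ball 0 1)"
    by (rule hol_map_on_cong[OF hol]) auto
qed (use bd in auto)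

lemma Hinf_add: "f \<in> Hinf \<Longrightarrow> g \<in> Hinf \<Longrightarrow> (\<lambda>x. f x + g x) \<in> Hinf"
  by (rule HinfI[OF hol_map_on_add norm_triangle_mono[OF norm_le_Hinf_norm norm_le_Hinf_norm]])
    (simp_all add: Hinf_hol_map_on Hinf_eq_0 del: mem_ball)

lemma Hinf_mult:
  assumes "f \<in> Hinf" "g \<in> Hinf"
  shows "(\<lambda>x. f x * g x) \<in> Hinf"
proof (rule HinfI)
  show "norm (f x * g x) \<le> Hinf_norm f * Hinf_norm g" for x
    unfolding norm_mult using assms by (intro mult_mono' norm_le_Hinf_norm) auto
qed (use assms in \<open>simp_all add: hol_map_on_mult Hinf_hol_map_on Hinf_eq_0 del: mem_ball\<close>)

lemma Hinf_cmult:
  assumes "f \<in> Hinf"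
  shows "(\<lambda>x. c * f x) \<in> Hinf"
proof (rule HinfI)
  show "norm (c * f x) \<le> norm c * Hinf_norm f" for x
    unfolding norm_mult using assms by (intro mult_left_mono norm_le_Hinf_norm) auto
qed (use assms in \<open>simp_all add: hol_map_on_mult hol_map_on_const Hinf_hol_map_on Hinf_eq_0
    del: mem_ball\<close>)

section \<open>Convergence of the canonical extension\<close>

text \<open>
  Continuous polynomials of degree at most \<open>m\<close> on \<open>c\<^sub>0\<close>, characterized by Liouville's theorem. In this form,
  lowering the degree by taking differences is a Cauchy estimate and needs no multilinear forms.
\<close>

definition entire_of_growth :: "nat \<Rightarrow> (c0 \<Rightarrow> complex) \<Rightarrow> bool" where
  "entire_of_growth m P \<longleftrightarrow> (\<forall>x h. (\<lambda>\<zeta>. P (x + \<zeta> *\<^sub>C h)) holomorphic_on UNIV) \<and>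
     (\<exists>C. \<forall>x. norm (P x) \<le> C * (1 + norm x) ^ m)"

lemma entire_of_growth_0: 
  assumes "entire_of_growth 0 P"
  shows "P x = P 0"
proof -
  obtain C where "\<And>x. norm (P x) \<le> C" using assms by (auto simp: entire_of_growth_def)
  then have "bounded (range (\<lambda>\<zeta>. P (0 + \<zeta> *\<^sub>C x)))" by (auto intro: boundedI)
  moreover have "(\<lambda>\<zeta>. P (0 + \<zeta> *\<^sub>C x)) holomorphic_on UNIV"
    using assms unfolding entire_of_growth_def by blast
  ultimately have "(\<lambda>\<zeta>. P (0 + \<zeta> *\<^sub>C x)) constant_on UNIV"
    by (rule Liouville_theorem[rotated])
  then obtain c where "\<And>\<zeta>. P (0 + \<zeta> *\<^sub>C x) = c" by (auto simp: constant_on_def)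
  from this[of 0] this[of 1] show ?thesis by simp
qed

text \<open>
  The difference is that of the values at \<open>1\<close> and \<open>0\<close> of \<open>\<zeta> \<mapsto> P (x + \<zeta> b)\<close>. On a disc with radius \<open>R\<close>
  comparable to \<open>1 + norm x\<close> this function has size \<open>R\<^sup>m\<^sup>+\<^sup>1\<close>, so its variation from \<open>0\<close> to \<open>1\<close> is of
  order \<open>R\<^sup>m\<^sup>+\<^sup>1 / R\<close>.
\<close>

lemma entire_of_growth_difference:
  assumes P: "entire_of_growth (Suc m) P"
  shows "entire_of_growth m (\<lambda>x. P (b + x) - P x)"
proof -
  have hol: "(\<lambda>\<zeta>. P (x + \<zeta> *\<^sub>C h)) holomorphic_on S" for x h S
    using P holomorphic_on_subset by (fastforce simp: entire_of_growth_def)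
  obtain C where C: "\<And>x. norm (P x) \<le> C * (1 + norm x) ^ Suc m"
    using P by (auto simp: entire_of_growth_def)
  have C0: "C \<ge> 0" using order_trans[OF norm_ge_zero C[of 0]] by simp
  have "norm (P (b + x) - P x) \<le> C * (1 + norm b) ^ Suc m * 2 ^ Suc m * (1 + norm x) ^ m" for x
  proof -
    \<comment> \<open>Any \<open>R \<ge> 2\<close> comparable to \<open>1 + norm x\<close> would do; \<open>R \<ge> 2\<close> keeps \<open>1 - 1 / R\<close> away from \<open>0\<close>.\<close>
    define R where "R = 2 + norm x"
    define M where "M = C * (R * (1 + norm b)) ^ Suc m"
    have R: "R \<ge> 2" by (simp add: R_def)
    have "norm (P (x + \<zeta> *\<^sub>C b)) \<le> M" if "\<zeta> \<in> ball 0 R" for \<zeta>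
    proof -
      have "1 + norm (x + \<zeta> *\<^sub>C b) \<le> 1 + norm x + R * norm b"
        using norm_triangle_ineq[of x "\<zeta> *\<^sub>C b"] that
          mult_right_mono[of "norm \<zeta>" R "norm b"] by (simp add: norm_scaleC)
      also have "\<dots> \<le> R * (1 + norm b)" by (simp add: R_def algebra_simps)
      finally have "C * (1 + norm (x + \<zeta> *\<^sub>C b)) ^ Suc m \<le> M"
        unfolding M_def using C0 by (intro mult_left_mono power_mono) auto
      then show ?thesis using C order_trans by blast
    qed
    from Taylor_remainder_bound[OF hol this, where \<zeta> = 1 and N = 1]
    have "norm (P (b + x) - P x) \<le> M * (1 / R) / (1 - 1 / R)"
      using R by (simp add: add.commute del: divide_divide_eq_left)
    also have "\<dots> \<le> M * (1 / R) / (1 / 2)"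
      using R C0 by (intro divide_left_mono mult_nonneg_nonneg)
        (auto simp: M_def field_simps)
    also have "\<dots> = 2 * C * (1 + norm b) ^ Suc m * R ^ m"
      using R unfolding M_def power_mult_distrib by (simp add: field_simps)
    also have "\<dots> \<le> 2 * C * (1 + norm b) ^ Suc m * (2 * (1 + norm x)) ^ m"
      using C0 by (intro mult_left_mono power_mono) (auto simp: R_def)
    finally show ?thesis by (simp only: power_mult_distrib power_Suc mult_ac)
  qed
  moreover have "(\<lambda>\<zeta>. P (b + (x + \<zeta> *\<^sub>C h)) - P (x + \<zeta> *\<^sub>C h)) holomorphic_on UNIV" for x h
    using hol[of "b + x" h UNIV] hol[of x h UNIV] by (intro holomorphic_intros) (simp_all add: add.assoc)
  ultimately show ?thesis unfolding entire_of_growth_def by blast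
qed

text \<open>
  If this failed, there would be blocks \<open>y\<close> arbitrarily far out with \<open>P y - P 0\<close> close to a fixed
  \<open>c \<noteq> 0\<close>. The hypothesis \<open>diff\<close> makes \<open>P (b + y) - P b\<close> close to \<open>P y - P 0\<close>, so adding \<open>M\<close> such
  blocks one after the other changes \<open>P\<close> by about \<open>M c\<close>. But sums of disjoint blocks of \<open>w\<close> stay in
  the ball of radius \<open>B\<close>, where \<open>P\<close> is bounded.
\<close>

lemma entire_of_growth_blocks:
  fixes w :: "nat \<Rightarrow> complex"
  assumes P: "entire_of_growth m P" and w: "\<And>k. norm (w k) \<le> B"
    and diff: "\<And>b e. 0 < e \<Longrightarrow> \<exists>N. \<forall>j\<ge>N. \<forall>i\<ge>j.
      norm (P (b + c0_fin {j..<i} w) - P (c0_fin {j..<i} w) - (P b - P 0)) < e"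
    and e: "0 < e"
  shows "\<exists>N. \<forall>j\<ge>N. \<forall>i\<ge>j. norm (P (c0_fin {j..<i} w) - P 0) < e"
proof (rule ccontr)
  assume "\<not> ?thesis"
  then have "\<forall>N. \<exists>j i. N \<le> j \<and> j \<le> i \<and> e \<le> norm (P (c0_fin {j..<i} w) - P 0)"
    by (auto simp: not_less)
  then obtain j i where ji: "\<And>N. N \<le> j N" "\<And>N. j N \<le> i N"
    and big: "\<And>N. e \<le> norm (P (c0_fin {j N..<i N} w) - P 0)"
    by metis
  define d where "d N = P (c0_fin {j N..<i N} w) - P 0" for N
  obtain C where C: "\<And>x. norm (P x) \<le> C * (1 + norm x) ^ m"
    using P by (auto simp: entire_of_growth_def)
  have C0: "C \<ge> 0" using order_trans[OF norm_ge_zero C[of 0]] by simp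
  have B0: "0 \<le> B" using order_trans[OF norm_ge_zero w] .
  have nb: "norm (c0_fin K w) \<le> B" if "finite K" for K
    using norm_c0_fin_le[OF that] w B0 by blast
  have Pb: "norm (P (c0_fin K w) - P 0) \<le> 2 * (C * (1 + B) ^ m)" if "finite K" for K
  proof -
    have "norm (P (c0_fin K w)) \<le> C * (1 + B) ^ m"
      by (rule order_trans[OF C mult_left_mono]) (use nb[OF that] C0 in \<open>auto intro: power_mono\<close>)
    moreover have "norm (P 0) \<le> C * (1 + B) ^ m"
      by (rule order_trans[OF C mult_left_mono]) (use B0 C0 in \<open>auto intro: power_mono\<close>)
    ultimately show ?thesis using norm_triangle_ineq4[of "P (c0_fin K w)" "P 0"] by linarith
  qed
  have "bounded (range d)" unfolding d_def using Pb by (auto intro: boundedI)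
  then obtain c \<sigma> where \<sigma>: "strict_mono \<sigma>" and c: "(\<lambda>n. d (\<sigma> n)) \<longlonglongrightarrow> c"
    using bounded_imp_convergent_subsequence[of d] unfolding o_def by blast
  have ce: "e \<le> norm c"
    using tendsto_lowerbound[OF tendsto_norm[OF c], of e] big by (simp add: d_def)
  have "\<exists>K. finite K \<and> norm (P (c0_fin K w) - P 0 - of_nat M * c) \<le> M * (e / 2)" for M
  proof (induction M)
    case 0
    then show ?case by (intro exI[of _ "{}"]) (simp add: c0_fin_def)
  next
    case (Suc M)
    then obtain K where K: "finite K"
      and IH: "norm (P (c0_fin K w) - P 0 - of_nat M * c) \<le> M * (e / 2)" by blast
    define b where "b = c0_fin K w"
    have e4: "e / 4 > 0" using e by simp
    obtain N1 where N1: "\<And>j i. N1 \<le> j \<Longrightarrow> j \<le> i \<Longrightarrow>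
        norm (P (b + c0_fin {j..<i} w) - P (c0_fin {j..<i} w) - (P b - P 0)) < e / 4"
      using diff[OF e4, of b] by blast
    obtain N2 where N2: "\<And>n. N2 \<le> n \<Longrightarrow> norm (d (\<sigma> n) - c) < e / 4"
      using LIMSEQ_D[OF c e4] by blast
    \<comment> \<open>Far enough out for both approximations, and beyond the support used so far.\<close>
    define n where "n = N1 + N2 + Suc (Max (insert 0 K))"
    define y where "y = c0_fin {j (\<sigma> n)..<i (\<sigma> n)} w"
    have big_n: "n \<le> j (\<sigma> n)" using seq_suble[OF \<sigma>, of n] ji(1) order_trans by blast
    have disj: "K \<inter> {j (\<sigma> n)..<i (\<sigma> n)} = {}"
    proof -
      have "k < n" if "k \<in> K" for k
      proof -
        have "k \<le> Max (insert 0 K)" using K that by (intro Max_ge) auto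
        then show ?thesis unfolding n_def by linarith
      qed
      then show ?thesis using big_n by fastforce
    qed
    have y: "norm (P (b + y) - P y - (P b - P 0)) < e / 4"
      unfolding y_def using big_n ji(2) by (intro N1) (auto simp: n_def)
    have d: "norm (P y - P 0 - c) < e / 4"
      using N2[of n] by (simp add: n_def y_def d_def)
    have "P (b + y) - P 0 - of_nat (Suc M) * c =
        (P (b + y) - P y - (P b - P 0)) + (P y - P 0 - c) + (P b - P 0 - of_nat M * c)"
      by (simp add: algebra_simps)
    also have "norm \<dots> \<le> e / 4 + e / 4 + M * (e / 2)"
      using y d IH unfolding b_def by (intro norm_triangle_mono) auto
    finally have "norm (P (b + y) - P 0 - of_nat (Suc M) * c) \<le> Suc M * (e / 2)"
      by (simp add: algebra_simps)
    moreover have "b + y = c0_fin (K \<union> {j (\<sigma> n)..<i (\<sigma> n)}) w"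
      unfolding b_def y_def c0_fin_def using K disj by (simp add: sum.union_disjoint)
    ultimately show ?case using K by (intro exI[of _ "K \<union> {j (\<sigma> n)..<i (\<sigma> n)}"]) auto
  qed
  moreover have "0 < e / 2" using e by simp
  then obtain M :: nat where M: "2 * (C * (1 + B) ^ m) < M * (e / 2)"
    using reals_Archimedean3 by blast
  ultimately obtain K where "finite K"
    and K: "norm (P (c0_fin K w) - P 0 - of_nat M * c) \<le> M * (e / 2)" by blast
  have "M * e \<le> norm (of_nat M * c)" using ce by (simp add: norm_mult mult_left_mono)
  also have "\<dots> \<le> norm (P (c0_fin K w) - P 0) + M * (e / 2)"
    using K norm_triangle_ineq4[of "P (c0_fin K w) - P 0" "P (c0_fin K w) - P 0 - of_nat M * c"]
    by simp
  finally show False using M Pb[OF \<open>finite K\<close>] by (simp add: field_simps)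
qed

text \<open>
  Induction on the degree, together with the convergence along blocks. Split \<open>w\<close> at a position \<open>j\<close>
  after which \<open>P\<close> is nearly constant on blocks, and let \<open>b\<close> be the part before \<open>j\<close>. Then \<open>P\<close> on a longer
  truncation is \<open>P (b + y) - P y\<close>, which has smaller degree in the tail \<open>y\<close>, plus the nearly constant
  \<open>P y\<close>.
\<close>

lemma entire_of_growth_Cauchy:
  fixes w :: "nat \<Rightarrow> complex"
  assumes "entire_of_growth m P" "\<And>k. norm (w k) \<le> B"
  shows "Cauchy (\<lambda>n. P (c0_fin {..<n} w))"
proof -
  have "(\<forall>e>0. \<exists>N. \<forall>j\<ge>N. \<forall>i\<ge>j. norm (P (c0_fin {j..<i} w) - P 0) < e) \<and>
      Cauchy (\<lambda>n. P (c0_fin {..<n} w))"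
    using assms
  proof (induction m arbitrary: P w)
    case 0
    have "P x = P 0" for x by (rule entire_of_growth_0[OF 0(1)])
    then have "P = (\<lambda>_. P 0)" by blast
    then show ?case by (metis (no_types, lifting) Cauchy_def diff_self dist_self norm_zero)
  next
    case (Suc m)
    let ?\<Delta> = "\<lambda>b x. P (b + x) - P x"
    have IH: "entire_of_growth m (?\<Delta> b)" for b
      by (rule entire_of_growth_difference[OF Suc.prems(1)])
    have blocks: "\<exists>N. \<forall>j\<ge>N. \<forall>i\<ge>j. norm (P (c0_fin {j..<i} w) - P 0) < e" if "e > 0" for e
    proof (rule entire_of_growth_blocks[OF Suc.prems _ that])
      show "\<exists>N. \<forall>j\<ge>N. \<forall>i\<ge>j. norm (P (b + c0_fin {j..<i} w) - P (c0_fin {j..<i} w)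
          - (P b - P 0)) < e" if "0 < e" for b e
        using Suc.IH[OF IH[of b] Suc.prems(2)] that by simp
    qed
    moreover have "Cauchy (\<lambda>n. P (c0_fin {..<n} w))"
    proof (rule metric_CauchyI)
      fix e :: real assume e: "e > 0"
      obtain j where j: "\<And>i. j \<le> i \<Longrightarrow> norm (P (c0_fin {j..<i} w) - P 0) < e / 4"
        using blocks[of "e / 4"] e by auto
      define b where "b = c0_fin {..<j} w"
      \<comment> \<open>Truncations of the tail of \<open>w\<close> are the blocks starting at \<open>j\<close>.\<close>
      define w' where "w' k = (if k < j then 0 else w k)" for k
      have B: "0 \<le> B" using order_trans[OF norm_ge_zero Suc.prems(2)[of 0]] .
      have "Cauchy (\<lambda>n. ?\<Delta> b (c0_fin {..<n} w'))"
      proof (rule Suc.IH[OF IH[of b], THEN conjunct2])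
        show "norm (w' k) \<le> B" for k using Suc.prems(2) B by (simp add: w'_def)
      qed
      then obtain N where N: "\<And>i k. N \<le> i \<Longrightarrow> N \<le> k \<Longrightarrow>
          dist (?\<Delta> b (c0_fin {..<i} w')) (?\<Delta> b (c0_fin {..<k} w')) < e / 4"
        using e metric_CauchyD[of _ "e / 4"] by (metis (no_types, lifting) divide_pos_pos zero_less_numeral)
      have tail: "c0_fin {..<i} w' = c0_fin {j..<i} w" if "j \<le> i" for i
        by (rule c0_eq_nthI) (auto simp: c0_nth_fin w'_def)
      have split: "c0_fin {..<i} w = b + c0_fin {j..<i} w" if "j \<le> i" for i
        unfolding b_def by (rule c0_eq_nthI) (use that in \<open>auto simp: c0_nth_fin plus_bcontfun.rep_eq\<close>)
      have "dist (P (c0_fin {..<i} w)) (P (c0_fin {..<k} w)) < e"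
        if "max j N \<le> i" "max j N \<le> k" for i k
      proof -
        have 1: "j \<le> i" "j \<le> k" using that by auto
        have "P (c0_fin {..<i} w) - P (c0_fin {..<k} w) =
            (?\<Delta> b (c0_fin {j..<i} w) - ?\<Delta> b (c0_fin {j..<k} w))
            + ((P (c0_fin {j..<i} w) - P 0) - (P (c0_fin {j..<k} w) - P 0))"
          by (simp add: split 1)
        also have "norm \<dots> \<le> e / 4 + (e / 4 + e / 4)"
          using N[of i k] that j[OF 1(1)] j[OF 1(2)] tail 1
          by (intro norm_triangle_mono order_trans[OF norm_triangle_ineq4 add_mono])
            (auto simp: dist_norm)
        also have "\<dots> < e" using e by simp
        finally show ?thesis by (simp add: dist_norm)
      qed
      then show "\<exists>M. \<forall>m\<ge>M. \<forall>n\<ge>M. dist (P (c0_fin {..<m} w)) (P (c0_fin {..<n} w)) < e"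
        by blast
    qed
    ultimately show ?case by blast
  qed
  then show ?thesis by blast
qed

text \<open>
  The \<open>m\<close>-homogeneous part of \<open>f\<close> at \<open>0\<close>.
\<close>

definition Taylor_part :: "(c0 \<Rightarrow> complex) \<Rightarrow> nat \<Rightarrow> c0 \<Rightarrow> complex" where
  "Taylor_part f m x = (deriv ^^ m) (\<lambda>\<zeta>. f (\<zeta> *\<^sub>C x)) 0 / fact m"

lemma Hinf_radial_holomorphic:
  assumes f: "f \<in> Hinf" and K: "norm x \<le> K" "0 < K"
  shows "(\<lambda>\<zeta>. f (\<zeta> *\<^sub>C x)) holomorphic_on ball 0 (1 / K)"
proof -
  have "\<zeta> *\<^sub>C x \<in> ball 0 1" if "norm \<zeta> < 1 / K" for \<zeta>
  proof -
    have "norm \<zeta> * norm x \<le> norm \<zeta> * K" using K by (simp add: mult_left_mono)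
    also have "\<dots> < 1" using that K by (simp add: field_simps)
    finally show ?thesis by (simp add: norm_scaleC)
  qed
  then show ?thesis
    using holomorphic_along_line[OF Hinf_hol_map_on[OF f], of 0 x]
    by (rule_tac holomorphic_on_subset) auto
qed

lemma Taylor_part_bound:
  assumes "f \<in> Hinf"
  shows "norm (Taylor_part f m x) \<le> Hinf_norm f * (1 + norm x) ^ m"
proof -
  have p: "0 < 1 + norm x" by (simp add: add_pos_nonneg)
  show ?thesis
    using Taylor_coeff_bound[OF Hinf_radial_holomorphic[OF assms, of x "1 + norm x"]
        norm_le_Hinf_norm[OF assms], of m] p
    by (simp add: Taylor_part_def power_one_over)
qed

lemma Taylor_part_remainder:
  assumes f: "f \<in> Hinf" and x: "norm x \<le> K" "0 < K" and t: "0 \<le> t" "t * K < 1"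
  shows "norm (f (complex_of_real t *\<^sub>C x) - (\<Sum>m<N. Taylor_part f m x * complex_of_real t ^ m))
    \<le> Hinf_norm f * (t * K) ^ N / (1 - t * K)"
  using Taylor_remainder_bound[OF Hinf_radial_holomorphic[OF f x] norm_le_Hinf_norm[OF f],
      of "complex_of_real t" N] t x
  by (simp add: Taylor_part_def field_simps)

text \<open>
  The part of degree \<open>m\<close> is the limit, as \<open>t \<rightarrow> 0\<close>, of \<open>f(t y)\<close> minus the parts of lower degree, divided
  by \<open>t\<^sup>m\<close>. By the remainder bound this limit is locally uniform in \<open>y\<close>, so holomorphy along lines
  follows by induction on \<open>m\<close>.
\<close>

lemma Taylor_part_holomorphic:
  assumes f: "f \<in> Hinf"
  shows "(\<lambda>\<zeta>. Taylor_part f m (x + \<zeta> *\<^sub>C h)) holomorphic_on UNIV"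
proof (induction m rule: less_induct)
  case (less m)
  have "(\<lambda>\<zeta>. Taylor_part f m (x + \<zeta> *\<^sub>C h)) holomorphic_on ball 0 \<rho>" for \<rho>
  proof -
    define K where "K = 1 + norm x + \<bar>\<rho>\<bar> * norm h"
    have K: "K > 0" by (auto simp: K_def intro!: add_pos_nonneg)
    have nK: "norm (x + \<zeta> *\<^sub>C h) \<le> K" if "\<zeta> \<in> ball 0 \<rho>" for \<zeta>
    proof -
      have "norm \<zeta> * norm h \<le> \<bar>\<rho>\<bar> * norm h" using that by (intro mult_right_mono) auto
      then show ?thesis using norm_triangle_ineq[of x "\<zeta> *\<^sub>C h"] by (simp add: norm_scaleC K_def)
    qed
    \<comment> \<open>Small enough that \<open>t n * K \<le> 1 / 2\<close> for all \<open>n\<close>.\<close>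
    define t where "t n = 1 / (real (n + 2) * K)" for n
    have t: "0 < t n" "t n * K = 1 / real (n + 2)" for n using K by (auto simp: t_def)
    define G where "G n \<zeta> = (f (complex_of_real (t n) *\<^sub>C (x + \<zeta> *\<^sub>C h))
        - (\<Sum>j<m. Taylor_part f j (x + \<zeta> *\<^sub>C h) * complex_of_real (t n) ^ j)) / of_real (t n) ^ m"
      for n \<zeta>
    have "(\<lambda>\<zeta>. f (complex_of_real (t n) *\<^sub>C (x + \<zeta> *\<^sub>C h))) holomorphic_on ball 0 \<rho>" for n
    proof -
      have "complex_of_real (t n) *\<^sub>C (x + \<zeta> *\<^sub>C h) =
          complex_of_real (t n) *\<^sub>C x + \<zeta> *\<^sub>C (complex_of_real (t n) *\<^sub>C h)" for \<zeta>
        by (simp add: scaleC_add_right scaleC_scaleC mult.commute)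
      moreover have "complex_of_real (t n) *\<^sub>C (x + \<zeta> *\<^sub>C h) \<in> ball 0 1" if "\<zeta> \<in> ball 0 \<rho>" for \<zeta>
      proof -
        have "t n * norm (x + \<zeta> *\<^sub>C h) \<le> t n * K"
          using nK[OF that] t(1)[of n] by (intro mult_left_mono) auto
        also have "\<dots> < 1" by (simp add: t)
        finally show ?thesis using t(1)[of n] by (simp add: norm_scaleC)
      qed
      ultimately show ?thesis
        using holomorphic_along_line[OF Hinf_hol_map_on[OF f],
            of "complex_of_real (t n) *\<^sub>C x" "complex_of_real (t n) *\<^sub>C h"]
        by (auto elim!: holomorphic_on_subset)
    qed
    then have holG: "G n holomorphic_on ball 0 \<rho>" for n
      unfolding G_def using t(1)[of n] less.IH
      by (intro holomorphic_intros) (auto intro: holomorphic_on_subset)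
    have bd: "norm (G n \<zeta> - Taylor_part f m (x + \<zeta> *\<^sub>C h)) \<le> 2 * Hinf_norm f * K ^ m * (1 / real (n + 2))"
      if "\<zeta> \<in> ball 0 \<rho>" for n \<zeta>
    proof -
      let ?y = "x + \<zeta> *\<^sub>C h"
      have tn: "t n \<noteq> 0" using t(1)[of n] by simp
      have H0: "0 \<le> Hinf_norm f" using order_trans[OF norm_ge_zero norm_le_Hinf_norm[OF f]] .
      have "G n \<zeta> - Taylor_part f m ?y = (f (complex_of_real (t n) *\<^sub>C ?y)
          - (\<Sum>j<Suc m. Taylor_part f j ?y * complex_of_real (t n) ^ j)) / of_real (t n) ^ m"
        using tn by (simp add: G_def field_simps)
      also have "norm \<dots> \<le> (Hinf_norm f * (t n * K) ^ Suc m / (1 - t n * K)) / t n ^ m"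
        unfolding norm_divide norm_power norm_of_real abs_of_pos[OF t(1)]
        using t(1)[of n] t(2)[of n] K nK[OF that]
        by (intro divide_right_mono Taylor_part_remainder[OF f]) auto
      also have "\<dots> = Hinf_norm f * K ^ m * (t n * K) / (1 - t n * K)"
        using tn by (simp add: power_mult_distrib)
      also have "\<dots> \<le> Hinf_norm f * K ^ m * (t n * K) / (1 / 2)"
        using H0 K t(1)[of n] unfolding t(2)
        by (intro divide_left_mono mult_nonneg_nonneg) (auto simp: field_simps)
      finally have "norm (G n \<zeta> - Taylor_part f m ?y) \<le> Hinf_norm f * K ^ m * (t n * K) / (1 / 2)" .
      then show ?thesis unfolding t(2) by (simp add: mult_ac)
    qed
    have ul: "uniform_limit (ball 0 \<rho>) G (\<lambda>\<zeta>. Taylor_part f m (x + \<zeta> *\<^sub>C h)) sequentially"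
    proof (rule uniform_limitI)
      fix e :: real assume "e > 0"
      have "(\<lambda>n. 2 * Hinf_norm f * K ^ m * (1 / real (n + 2))) \<longlonglongrightarrow> 2 * Hinf_norm f * K ^ m * 0"
        by (intro tendsto_intros LIMSEQ_ignore_initial_segment lim_1_over_n)
      then have "\<forall>\<^sub>F n in sequentially. 2 * Hinf_norm f * K ^ m * (1 / real (n + 2)) < e"
        using order_tendstoD(2) \<open>e > 0\<close> by fastforce
      then show "\<forall>\<^sub>F n in sequentially. \<forall>\<zeta>\<in>ball 0 \<rho>. dist (G n \<zeta>) (Taylor_part f m (x + \<zeta> *\<^sub>C h)) < e"
        unfolding dist_norm by (rule eventually_mono) (blast intro: le_less_trans[OF bd])
    qed
    show ?thesis
    proof (rule holomorphic_uniform_sequence[OF open_ball holG])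
      fix \<zeta> assume "\<zeta> \<in> ball (0::complex) \<rho>"
      then obtain d where "d > 0" "cball \<zeta> d \<subseteq> ball 0 \<rho>" using open_contains_cball open_ball by blast
      then show "\<exists>d>0. cball \<zeta> d \<subseteq> ball 0 \<rho> \<and>
          uniform_limit (cball \<zeta> d) G (\<lambda>\<zeta>. Taylor_part f m (x + \<zeta> *\<^sub>C h)) sequentially"
        using uniform_limit_on_subset[OF ul] by blast
    qed
  qed
  then have "(\<lambda>\<zeta>. Taylor_part f m (x + \<zeta> *\<^sub>C h)) holomorphic_on (\<Union>\<rho>. ball 0 \<rho>)"
    by (intro holomorphic_on_UN_open) auto
  moreover have "(\<Union>\<rho>. ball (0::complex) \<rho>) = UNIV"
by (auto intro: gt_ex)
  ultimately show ?case by simp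
qed

text \<open>
  The truncations of \<open>w\<close> stay in a ball of radius \<open>s < 1\<close>, on which \<open>f\<close> is the uniform limit of finite
  sums of its homogeneous parts.
\<close>

lemma Hinf_truncate_convergent:
  assumes f: "f \<in> Hinf" and w: "w \<in> ball 0 1"
  shows "(\<lambda>n. f (c0_truncate n w)) \<longlonglongrightarrow> canonical_ext f w"
proof -
  define s where "s = (norm w + 1) / 2"
  have s: "0 < s" "s < 1" "norm w \<le> s" using w by (auto simp: s_def add_nonneg_pos)
  define P where "P N x = (\<Sum>m<N. Taylor_part f m x)" for N x
  have rem: "norm (f (c0_truncate n w) - P N (c0_truncate n w)) \<le> Hinf_norm f * s ^ N / (1 - s)"
    for n N
    using Taylor_part_remainder[OF f _ s(1), of "c0_truncate n w" 1 N] s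
      norm_c0_truncate_le[of n w] by (simp add: P_def)
  have "Cauchy (\<lambda>n. f (c0_truncate n w))"
  proof (rule metric_CauchyI)
    fix e :: real assume e: "e > 0"
    have "(\<lambda>N. Hinf_norm f * s ^ N / (1 - s)) \<longlonglongrightarrow> Hinf_norm f * 0 / (1 - s)"
      using s by (intro tendsto_intros LIMSEQ_power_zero) auto
    then have "\<forall>\<^sub>F N in sequentially. Hinf_norm f * s ^ N / (1 - s) < e / 3"
      by (rule order_tendstoD(2)) (use e in simp)
    then obtain N where N: "Hinf_norm f * s ^ N / (1 - s) < e / 3"
      using eventually_happens'[of sequentially] by auto
    have "convergent (\<lambda>n. Taylor_part f m (c0_truncate n w))" for m
    proof -
      have "entire_of_growth m (Taylor_part f m)"
        using Taylor_part_holomorphic[OF f] Taylor_part_bound[OF f]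
        unfolding entire_of_growth_def by blast
      from entire_of_growth_Cauchy[OF this norm_bounded[of w]] show ?thesis
        by (simp add: c0_truncate_eq_fin Cauchy_convergent_iff)
    qed
    then have "Cauchy (\<lambda>n. P N (c0_truncate n w))"
      unfolding P_def by (intro convergent_Cauchy convergent_sum)
    then obtain M where M: "\<And>i j. M \<le> i \<Longrightarrow> M \<le> j \<Longrightarrow>
        dist (P N (c0_truncate i w)) (P N (c0_truncate j w)) < e / 3"
      using metric_CauchyD[of _ "e / 3"] e by (metis (no_types, lifting) divide_pos_pos zero_less_numeral)
    have "dist (f (c0_truncate i w)) (f (c0_truncate j w)) < e" if "M \<le> i" "M \<le> j" for i j
      using M[OF that] le_less_trans[OF rem[of i N] N] le_less_trans[OF rem[of j N] N]
        dist_triangle_third[of "f (c0_truncate i w)" "P N (c0_truncate i w)" e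
          "P N (c0_truncate j w)" "f (c0_truncate j w)"]
      by (simp add: dist_norm norm_minus_commute)
    then show "\<exists>M. \<forall>m\<ge>M. \<forall>n\<ge>M. dist (f (c0_truncate m w)) (f (c0_truncate n w)) < e" by blast
  qed
  then show ?thesis
    unfolding canonical_ext_def by (simp add: Cauchy_convergent_iff convergent_LIMSEQ_iff)
qed

section \<open>Involutions of the disc\<close>

text \<open>
  The automorphism of the unit disc that exchanges \<open>0\<close> and \<open>r\<close>.
\<close>

definition disc_inv :: "real \<Rightarrow> complex \<Rightarrow> complex" where
  "disc_inv r u = (of_real r - u) / (1 - of_real r * u)"

lemma disc_inv_denom:
  fixes u :: complex
  assumes "0 < r" "r < 1" "norm u \<le> 1"
  shows "1 - of_real r * u \<noteq> 0"
proof
  assume "1 - of_real r * u = 0"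
  then have "norm (complex_of_real r * u) = 1" by simp
  moreover have "norm (complex_of_real r * u) \<le> r * 1"
    unfolding norm_mult using assms by (intro mult_mono) auto
  ultimately show False using assms by simp
qed

lemma disc_inv_norm_less_1:
  assumes "0 < r" "r < 1" "norm u < 1"
  shows "norm (disc_inv r u) < 1"
proof -
  have "(norm (1 - of_real r * u))\<^sup>2 - (norm (of_real r - u))\<^sup>2 = (1 - r\<^sup>2) * (1 - (norm u)\<^sup>2)"
    unfolding cmod_power2 by (simp add: power2_eq_square algebra_simps)
  also have "\<dots> > 0"
    using assms by (intro mult_pos_pos) (auto simp: power_less_one_iff abs_square_less_1)
  finally have "norm (of_real r - u) < norm (1 - of_real r * u)"
    by (simp add: power_less_imp_less_base)
  then show ?thesis
    using disc_inv_denom[of r u] assms by (simp add: disc_inv_def norm_divide divide_less_eq_1)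
qed

lemma disc_inv_involution:
  assumes "0 < r" "r < 1" "norm u < 1"
  shows "disc_inv r (disc_inv r u) = u"
proof -
  define d where "d = 1 - of_real r * u"
  have d: "d \<noteq> 0" using disc_inv_denom[of r u] assms by (simp add: d_def)
  have r: "1 - (of_real r)\<^sup>2 \<noteq> (0::complex)"
  proof -
    have "1 - r\<^sup>2 \<noteq> 0" using assms abs_square_less_1[of r] by auto
    then have "complex_of_real (1 - r\<^sup>2) \<noteq> 0" by (simp only: of_real_eq_0_iff not_False_eq_True)
    then show ?thesis by simp
  qed
  have "of_real r - disc_inv r u = u * (1 - (of_real r)\<^sup>2) / d"
    "1 - of_real r * disc_inv r u = (1 - (of_real r)\<^sup>2) / d"
    using d unfolding disc_inv_def d_def[symmetric]
    by (simp_all add: divide_simps) (simp_all add: d_def algebra_simps power2_eq_square)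
  then show ?thesis
    using d r by (simp add: disc_inv_def[of r "disc_inv r u"])
qed

text \<open>
  On the radius opposite to its zero, the function moves only from \<open>r\<close> to \<open>1\<close>.
\<close>

lemma disc_inv_near_1:
  assumes "0 < r" "r < 1" "0 \<le> t" "t \<le> 1"
  shows "norm (disc_inv r (- of_real t) - 1) \<le> 1 - r"
proof -
  have p: "1 + r * t > 0" using assms by (simp add: add_pos_nonneg)
  have "disc_inv r (- of_real t) - 1 = of_real ((r + t) / (1 + r * t) - 1)"
    by (simp add: disc_inv_def)
  also have "(r + t) / (1 + r * t) - 1 = - ((1 - r) * (1 - t) / (1 + r * t))"
    using p by (simp add: field_simps)
  also have "norm (complex_of_real \<dots>) = (1 - r) * (1 - t) / (1 + r * t)"
    unfolding norm_of_real abs_minus_cancel using p assms by (intro abs_of_nonneg) auto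
  also have "\<dots> \<le> (1 - r) * 1 / 1"
    using assms p by (intro frac_le mult_left_mono) auto
  finally show ?thesis by simp
qed

lemma disc_inv_holomorphic:
  assumes "0 < r" "r < 1"
  shows "disc_inv r holomorphic_on ball 0 1"
  unfolding disc_inv_def using disc_inv_denom[OF assms] by (intro holomorphic_intros) (simp add: less_imp_le)

lemma hol_map_on_disc_inv:
  assumes "0 < r" "r < 1" "hol_map_on f S" "\<And>x. x \<in> S \<Longrightarrow> norm (f x) < 1"
  shows "hol_map_on (\<lambda>x. disc_inv r (f x)) S"
  by (rule hol_map_on_compose[OF assms(3) holomorphic_on_imp_hol_map_on[OF
          disc_inv_holomorphic[OF assms(1,2)] open_ball]]) (use assms(4) in auto)

lemma disc_inv_at_1: "0 < r \<Longrightarrow> r < 1 \<Longrightarrow> disc_inv r 1 = - 1"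
  using disc_inv_denom[of r 1] by (simp add: disc_inv_def divide_eq_minus_1_iff)

lemma disc_inv_tendsto_1:
  assumes "norm u < 1"
  shows "((\<lambda>r. disc_inv r u) \<longlongrightarrow> 1) (at_left 1)"
proof -
  have "u \<noteq> 1" using assms by auto
  then have "((\<lambda>r. disc_inv r u) \<longlongrightarrow> (of_real 1 - u) / (1 - of_real 1 * u)) (at_left 1)"
    unfolding disc_inv_def by (intro tendsto_intros) auto
  then show ?thesis using \<open>u \<noteq> 1\<close> by simp
qed

definition radius :: "nat \<Rightarrow> real" where
  "radius n = 1 - (1 / 2) ^ Suc n"

lemma radius_bounds: "0 < radius n" "radius n < 1"
proof -
  have "(1 / 2 :: real) ^ Suc n \<le> 1 / 2" by (simp add: power_le_one)
  then show "0 < radius n" unfolding radius_def by linarith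
qed (simp add: radius_def)

lemma radius_tendsto: "radius \<longlonglongrightarrow> 1"
  unfolding radius_def[abs_def]
  using tendsto_diff[OF tendsto_const[of 1] LIMSEQ_Suc[OF LIMSEQ_power_zero[of "1/2 :: real"]]]
  by simp

lemma sum_radius_tail:
  assumes "finite I" "I \<subseteq> {N..}"
  shows "(\<Sum>n\<in>I. 1 - radius n) \<le> (1 / 2) ^ N"
proof -
  obtain M where M: "I \<subseteq> {..<M}" using assms(1) finite_nat_iff_bounded by blast
  have geo: "(\<Sum>n=N..<N + l. 1 - radius n) = (1 / 2) ^ N - (1 / 2) ^ (N + l)" for l
    by (induction l) (auto simp: radius_def)
  have "(\<Sum>n\<in>I. 1 - radius n) \<le> (\<Sum>n=N..<N + M. 1 - radius n)"
    using assms(2) M less_imp_le[OF radius_bounds(2)] by (intro sum_mono2) (auto simp: subset_iff)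
  also have "\<dots> \<le> (1 / 2) ^ N" unfolding geo by simp
  finally show ?thesis .
qed

section \<open>Spreading a sequence over a block of coordinates\<close>

text \<open>
  A unimodular number pointing opposite to the entry of \<open>z\<close>, so that the rotation taking it to \<open>1\<close>
  takes this entry to a real number that is at most \<open>0\<close>.
\<close>

definition away :: "linf \<Rightarrow> nat \<Rightarrow> complex" where
  "away z j = (if apply_bcontfun z j = 0 then 1 else - sgn (apply_bcontfun z j))"

lemma norm_away: "norm (away z j) = 1"
  by (simp add: away_def norm_sgn)

lemma cnj_away_mult: "cnj (away z j) * apply_bcontfun z j = - of_real (norm (apply_bcontfun z j))"
proof -
  let ?v = "apply_bcontfun z j"
  have "cnj (- sgn ?v) * ?v = - (?v * cnj ?v / of_real (norm ?v))"
    by (simp add: sgn_eq mult.commute)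
  also have "\<dots> = - of_real (norm ?v)"
    unfolding complex_norm_square[symmetric] by (simp add: power2_eq_square)
  finally show ?thesis by (simp add: away_def)
qed

lemma cnj_away_away: "cnj (away z j) * away z j = 1"
  using complex_norm_square[of "away z j"] by (simp add: norm_away mult.commute)

text \<open>
  The support of \<open>spread\<close> is cut to finitely many positions for it to lie in \<open>c\<^sub>0\<close>. The two parts of the
  support are disjoint, since \<open>prod_encode (i, k) \<ge> i\<close>.
\<close>

definition spread_coord :: "linf \<Rightarrow> nat \<Rightarrow> (nat \<Rightarrow> complex) \<Rightarrow> nat \<Rightarrow> complex" where
  "spread_coord z i w j = (case prod_decode j of (n, k) \<Rightarrow>
     if n = i then away z j * disc_inv (radius i) (w k) else of_real (radius i) * apply_bcontfun z j)"

definition spread :: "linf \<Rightarrow> nat \<Rightarrow> (nat \<Rightarrow> complex) \<Rightarrow> c0" where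
  "spread z i w = c0_fin ({..<i} \<union> (\<lambda>k. prod_encode (i, k)) ` {..<i}) (spread_coord z i w)"

lemma c0_nth_spread:
  "c0_nth (spread z i w) (prod_encode (n, k)) =
     (if n = i \<and> k < i then away z (prod_encode (n, k)) * disc_inv (radius i) (w k)
      else if prod_encode (n, k) < i then of_real (radius i) * apply_bcontfun z (prod_encode (n, k))
      else 0)"
  using le_prod_encode_1[of i k] by (auto simp: spread_def c0_nth_fin spread_coord_def)

lemma c0_nth_spread_less:
  assumes "j < i"
  shows "c0_nth (spread z i w) j = of_real (radius i) * apply_bcontfun z j"
proof -
  obtain n k where "j = prod_encode (n, k)" by (metis prod_decode_inverse surj_pair)
  then show ?thesis using assms le_prod_encode_1[of n k] by (auto simp: c0_nth_spread)
qed

lemma spread_cong: "(\<And>k. k < i \<Longrightarrow> w k = w' k) \<Longrightarrow> spread z i w = spread z i w'"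
proof (rule c0_eq_nthI)
  fix j assume *: "\<And>k. k < i \<Longrightarrow> w k = w' k"
  obtain n k where "j = prod_encode (n, k)" by (metis prod_decode_inverse surj_pair)
  then show "c0_nth (spread z i w) j = c0_nth (spread z i w') j" using * by (simp add: c0_nth_spread)
qed

lemma norm_spread_less_1:
  assumes z: "norm z \<le> 1" and w: "\<And>k. norm (w k) < 1"
  shows "norm (spread z i w) < 1"
  unfolding spread_def
proof (rule norm_c0_fin_less_1)
  fix j
  have "radius i * norm (apply_bcontfun z j) \<le> radius i * 1"
    using radius_bounds(1)[of i] order_trans[OF norm_bounded z] by (intro mult_left_mono) auto
  also have "\<dots> < 1" using radius_bounds by simp
  finally have "norm (of_real (radius i) * apply_bcontfun z j) < 1"
    using radius_bounds(1)[of i] by (simp add: norm_mult)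
  then show "norm (spread_coord z i w j) < 1"
    using disc_inv_norm_less_1[OF radius_bounds w]
    by (auto simp: spread_coord_def norm_mult norm_away split: prod.split)
qed simp

lemma norm_nth_less_1: "w \<in> ball 0 1 \<Longrightarrow> norm (apply_bcontfun w k) < 1"
  using le_less_trans[OF norm_bounded] by simp

lemma hol_map_on_spread: "hol_map_on (\<lambda>w :: linf. spread z i (apply_bcontfun w)) (ball 0 1)"
  unfolding spread_def
proof (rule hol_map_on_c0_fin)
  fix j
  obtain n k where j: "prod_decode j = (n, k)" by force
  show "hol_map_on (\<lambda>w. spread_coord z i (apply_bcontfun w) j) (ball 0 1)"
    unfolding spread_coord_def j
  proof (cases "n = i")
    case True
    then show "hol_map_on (\<lambda>w. case (n, k) of (n, k) \<Rightarrow>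
        if n = i then away z j * disc_inv (radius i) (apply_bcontfun w k)
        else of_real (radius i) * apply_bcontfun z j) (ball 0 1)"
      by (auto intro!: hol_map_on_mult hol_map_on_const hol_map_on_disc_inv hol_map_on_nth
        norm_nth_less_1 radius_bounds simp del: mem_ball)
  next
    case False
    then show "hol_map_on (\<lambda>w. case (n, k) of (n, k) \<Rightarrow>
        if n = i then away z j * disc_inv (radius i) (apply_bcontfun w k)
        else of_real (radius i) * apply_bcontfun z j) (ball 0 1)"
      by (simp add: hol_map_on_const)
  qed
qed

section \<open>Products that recover the coordinates\<close>

definition block_factor :: "linf \<Rightarrow> nat \<Rightarrow> nat \<Rightarrow> c0 \<Rightarrow> complex" where
  "block_factor z k n x =
     disc_inv (radius n) (cnj (away z (prod_encode (n, k))) * c0_nth x (prod_encode (n, k)))"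

text \<open>
  Being bounded by \<open>1\<close> on the ball, the partial products have a limit along \<open>F\<close>, and its holomorphy in \<open>x\<close> is a
  case of \<open>hol_map_on_Lim\<close>; no estimate for infinite products enters.
\<close>

definition block_product :: "nat filter \<Rightarrow> linf \<Rightarrow> nat set \<Rightarrow> nat \<Rightarrow> c0 \<Rightarrow> complex" where
  "block_product F z A k x = Lim F (\<lambda>M. \<Prod>n\<in>A \<inter> {..<M}. block_factor z k n x)"

lemma block_factor_arg: 
  "norm x < 1 \<Longrightarrow> norm (cnj (away z j) * c0_nth x j) < 1"
  using le_less_trans[OF norm_c0_nth_le] by (simp add: norm_mult norm_away)

lemma norm_block_factor: "norm x < 1 \<Longrightarrow> norm (block_factor z k n x) < 1"
  unfolding block_factor_def by (intro disc_inv_norm_less_1 radius_bounds block_factor_arg)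

lemma norm_block_prod_le_1: "norm x < 1 \<Longrightarrow> norm (\<Prod>n\<in>I. block_factor z k n x) \<le> 1"
  unfolding prod_norm[symmetric] by (intro prod_le_1) (auto intro: less_imp_le norm_block_factor)

lemma block_product_tendsto:
  assumes "free_limit_filter F" "norm x < 1"
  shows "((\<lambda>M. \<Prod>n\<in>A \<inter> {..<M}. block_factor z k n x) \<longlongrightarrow> block_product F z A k x) F"
  unfolding block_product_def by (rule Lim_tendsto[OF assms(1) norm_block_prod_le_1[OF assms(2)]])

lemma hol_map_on_block_product:
  assumes "free_limit_filter F"
  shows "hol_map_on (block_product F z A k) (ball 0 1)"
  unfolding block_product_def[abs_def]
proof (rule hol_map_on_Lim[OF assms open_ball])
  show "hol_map_on (\<lambda>x. \<Prod>n\<in>A \<inter> {..<M}. block_factor z k n x) (ball 0 1)" for M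
    unfolding block_factor_def
    by (intro hol_map_on_prod hol_map_on_disc_inv radius_bounds hol_map_on_mult hol_map_on_const
        hol_map_on_c0_nth block_factor_arg) simp
  show "norm (\<Prod>n\<in>A \<inter> {..<M}. block_factor z k n x) \<le> 1" if "x \<in> ball 0 1" for M x
    using that by (intro norm_block_prod_le_1) simp
qed

text \<open>
  All factors have modulus below \<open>1\<close>, so the product is bounded by any single one of them. The strict
  bound is what allows the product to be inserted into functions defined on open discs.
\<close>

lemma norm_block_product_less_1:
  assumes F: "free_limit_filter F" and x: "norm x < 1" and A: "A \<noteq> {}"
  shows "norm (block_product F z A k x) < 1"
proof -
  obtain a where a: "a \<in> A" using A by blast
  have le: "norm (\<Prod>n\<in>A \<inter> {..<M}. block_factor z k n x) \<le> norm (block_factor z k a x)"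
    if "Suc a \<le> M" for M
  proof -
    have "(\<Prod>n\<in>A \<inter> {..<M}. block_factor z k n x)
        = block_factor z k a x * (\<Prod>n\<in>A \<inter> {..<M} - {a}. block_factor z k n x)"
      using a that by (intro prod.remove) auto
    then show ?thesis
      using mult_left_mono[OF norm_block_prod_le_1[OF x, of z k "A \<inter> {..<M} - {a}"]
          norm_ge_zero[of "block_factor z k a x"]] by (simp add: norm_mult)
  qed
  have ev: "\<forall>\<^sub>F M in F. norm (\<Prod>n\<in>A \<inter> {..<M}. block_factor z k n x) \<le> norm (block_factor z k a x)"
    by (rule eventually_mono[OF eventually_ge_free_limit_filter[OF F] le])
  have "norm (block_product F z A k x) \<le> norm (block_factor z k a x)"
    using F by (intro tendsto_upperbound[OF tendsto_norm[OF block_product_tendsto[OF F x]] ev])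
      (simp add: free_limit_filter_def)
  then show ?thesis using norm_block_factor[OF x] by (rule le_less_trans)
qed

lemma block_factor_spread_other:
  assumes z: "norm z \<le> 1" and n: "n \<noteq> i"
  shows "norm (block_factor z k n (spread z i w) - 1) \<le> 1 - radius n"
proof -
  define j where "j = prod_encode (n, k)"
  define t where "t = (if j < i then radius i * norm (apply_bcontfun z j) else 0)"
  have "radius i * norm (apply_bcontfun z j) \<le> 1 * 1"
    using radius_bounds[of i] order_trans[OF norm_bounded z] by (intro mult_mono) auto
  then have t: "0 \<le> t" "t \<le> 1" using radius_bounds(1)[of i] by (auto simp: t_def)
  have "cnj (away z j) * c0_nth (spread z i w) j = - of_real t"
    using n cnj_away_mult[of z j] by (simp add: j_def t_def c0_nth_spread mult.left_commute)
  then have "block_factor z k n (spread z i w) = disc_inv (radius n) (- of_real t)"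
    by (simp add: block_factor_def j_def)
  then show ?thesis using disc_inv_near_1[OF radius_bounds t] by simp
qed

lemma block_factor_spread_same:
  assumes "norm (w k) < 1" "k < i"
  shows "block_factor z k i (spread z i w) = w k"
  using assms disc_inv_involution[OF radius_bounds assms(1), of i]
  by (simp add: block_factor_def c0_nth_spread mult.assoc[symmetric] cnj_away_away)

text \<open>
  Compare the product with the one in which the factor of index \<open>i\<close> is kept, being exactly \<open>w k\<close>, and
  all others are replaced by \<open>1\<close>. Factors have modulus at most \<open>1\<close>, so the errors \<open>1 - radius n\<close> add up.
\<close>

lemma block_product_spread:
  assumes F: "free_limit_filter F" and z: "norm z \<le> 1" and w: "\<And>k. norm (w k) < 1"
    and A: "A \<subseteq> {N..}" and k: "k < i"
  shows "norm (block_product F z A k (spread z i w) - (if i \<in> A then w k else 1)) \<le> (1 / 2) ^ N"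
proof -
  let ?x = "spread z i w"
  have x: "norm ?x < 1" by (rule norm_spread_less_1[OF z w])
  \<comment> \<open>The values that the factors nearly have.\<close>
  define c where "c n = (if n = i then w k else 1)" for n
  have le: "norm ((\<Prod>n\<in>A \<inter> {..<M}. block_factor z k n ?x) - (if i \<in> A then w k else 1)) \<le> (1 / 2) ^ N"
    if M: "Suc i \<le> M" for M
  proof -
    have c: "(\<Prod>n\<in>A \<inter> {..<M}. c n) = (if i \<in> A then w k else 1)"
      using M by (simp add: c_def prod.delta)
    have "norm ((\<Prod>n\<in>A \<inter> {..<M}. block_factor z k n ?x) - (\<Prod>n\<in>A \<inter> {..<M}. c n))
        \<le> (\<Sum>n\<in>A \<inter> {..<M}. norm (block_factor z k n ?x - c n))"
      using norm_block_factor[OF x] w[of k]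
      by (intro norm_prod_diff) (auto simp: c_def less_imp_le)
    moreover have "\<dots> \<le> (\<Sum>n\<in>A \<inter> {..<M}. 1 - radius n)"
      using block_factor_spread_other[OF z] block_factor_spread_same[of w k i z] w k
        less_imp_le[OF radius_bounds(2)]
      by (intro sum_mono) (auto simp: c_def)
    moreover have "\<dots> \<le> (1 / 2) ^ N" using A by (intro sum_radius_tail) auto
    ultimately show ?thesis unfolding c by linarith
  qed
  have ev: "\<forall>\<^sub>F M in F. norm ((\<Prod>n\<in>A \<inter> {..<M}. block_factor z k n ?x)
      - (if i \<in> A then w k else 1)) \<le> (1 / 2) ^ N"
    by (rule eventually_mono[OF eventually_ge_free_limit_filter[OF F] le])
  show ?thesis
    using F by (intro tendsto_upperbound[OF tendsto_norm[OF tendsto_diff[OF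
            block_product_tendsto[OF F x] tendsto_const]] ev]) (simp add: free_limit_filter_def)
qed

section \<open>Embedding the ball into a fiber\<close>

text \<open>
  With \<open>F\<close> the filter of \<open>\<eta>\<close>, this is the map \<open>\<Phi>\<^sub>z\<^sup>\<eta>\<close> of the theorem.
\<close>

definition fiber_embedding ::
    "nat filter \<Rightarrow> linf \<Rightarrow> linf \<Rightarrow> (c0 \<Rightarrow> complex) \<Rightarrow> complex" where
  "fiber_embedding F z w = (\<lambda>f\<in>Hinf. Lim F (\<lambda>i. f (spread z i (apply_bcontfun w))))"

lemma fiber_embedding_tendsto:
  assumes "free_limit_filter F" "f \<in> Hinf"
  shows "((\<lambda>i. f (spread z i (apply_bcontfun w))) \<longlongrightarrow> fiber_embedding F z w f) F"
  using Lim_tendsto[OF assms(1) norm_le_Hinf_norm[OF assms(2)]] assms(2)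
  by (simp add: fiber_embedding_def)

lemma fiber_embedding_eqI:
  assumes F: "free_limit_filter F" and f: "f \<in> Hinf"
    and lim: "((\<lambda>i. f (spread z i (apply_bcontfun w))) \<longlongrightarrow> L) F"
  shows "fiber_embedding F z w f = L"
  by (rule tendsto_unique[OF free_limit_filter_neq_bot[OF F] fiber_embedding_tendsto[OF F f] lim])

lemma norm_fiber_embedding_le:
  assumes F: "free_limit_filter F" and f: "f \<in> Hinf"
  shows "norm (fiber_embedding F z w f) \<le> Hinf_norm f"
  by (rule tendsto_upperbound[OF tendsto_norm[OF fiber_embedding_tendsto[OF F f]]
        always_eventually free_limit_filter_neq_bot[OF F]]) (simp add: norm_le_Hinf_norm[OF f])

lemma norm_spread_linf_less_1:
  "norm z \<le> 1 \<Longrightarrow> w \<in> ball 0 1 \<Longrightarrow> norm (spread z i (apply_bcontfun w)) < 1"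
  by (intro norm_spread_less_1 norm_nth_less_1)

lemma fiber_embedding_in_spectrum:
  assumes F: "free_limit_filter F" and z: "norm z \<le> 1" and w: "w \<in> ball 0 1"
  shows "fiber_embedding F z w \<in> spectrum_Hinf"
  unfolding spectrum_Hinf_def
proof (intro CollectI conjI ballI allI)
  let ?\<phi> = "fiber_embedding F z w"
  note lim = fiber_embedding_tendsto[OF F, of _ z w]
  show "?\<phi> \<in> extensional Hinf" by (simp add: fiber_embedding_def)
  fix f assume f: "f \<in> Hinf"
  show "?\<phi> (\<lambda>x. c * f x) = c * ?\<phi> f" for c
    by (intro fiber_embedding_eqI F Hinf_cmult f tendsto_mult tendsto_const lim)
  fix g assume g: "g \<in> Hinf"
  show "?\<phi> (\<lambda>x. f x + g x) = ?\<phi> f + ?\<phi> g"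
    by (intro fiber_embedding_eqI F Hinf_add f g tendsto_add lim)
  show "?\<phi> (\<lambda>x. f x * g x) = ?\<phi> f * ?\<phi> g"
    by (intro fiber_embedding_eqI F Hinf_mult f g tendsto_mult lim)
next
  let ?one = "\<lambda>x :: c0. if x \<in> ball 0 1 then 1 else 0 :: complex"
  have one: "?one \<in> Hinf" by (rule Hinf_restrictI[OF hol_map_on_const, of _ 1]) simp
  have "fiber_embedding F z w ?one = 1"
    using norm_spread_linf_less_1[OF z w] by (intro fiber_embedding_eqI[OF F one]) simp
  then show "\<exists>f\<in>Hinf. fiber_embedding F z w f \<noteq> 0"
    using one by (intro bexI[of _ ?one]) auto
qed

lemma ell1_on_ball_in_Hinf:
  assumes a: "a \<in> ell1"
  shows "ell1_on_ball a \<in> Hinf"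
proof -
  let ?L = "\<lambda>x. \<Sum>n. a n * c0_nth x n"
  have sa: "summable (\<lambda>n. norm (a n))" using a by (simp add: ell1_def)
  have bd: "norm (a n * c0_nth x n) \<le> norm (a n) * norm x" for n x
    by (simp add: norm_mult mult_left_mono norm_c0_nth_le)
  have s: "summable (\<lambda>n. a n * c0_nth x n)" for x
    by (rule summable_comparison_test'[OF summable_mult2[OF sa] bd])
  have L: "norm (?L x) \<le> norm x * (\<Sum>n. norm (a n))" for x
    using norm_suminf_le[OF bd summable_mult2[OF sa], of x] suminf_mult2[OF sa, of "norm x"]
    by (simp add: mult.commute)
  have "bounded_linear ?L"
  proof
    show "?L (x + y) = ?L x + ?L y" for x y
      using suminf_add[OF s s, of x y] by (simp add: plus_bcontfun.rep_eq algebra_simps)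
    show "?L (r *\<^sub>R x) = r *\<^sub>R ?L x" for r x
      using suminf_scaleR_right[OF s, of r x] by simp
    show "\<exists>K. \<forall>x. norm (?L x) \<le> norm x * K" using L by blast
  qed
  then have "hol_map_on ?L (ball 0 1)"
  proof (rule hol_map_on_linear)
    show "?L (c *\<^sub>C x) = c *\<^sub>C ?L x" for c x
      using suminf_mult[OF s, of c x] by (simp add: mult.left_commute)
  qed
  moreover have "norm (?L x) \<le> (\<Sum>n. norm (a n))" if "norm x < 1" for x
    using L[of x] mult_right_mono[of "norm x" 1 "\<Sum>n. norm (a n)"] that suminf_nonneg[OF sa] by simp
  ultimately show ?thesis
    using Hinf_restrictI[of ?L "\<Sum>n. norm (a n)"] by (simp add: ell1_on_ball_def[abs_def])
qed

text \<open>
  Each coordinate of the points \<open>spread z i w\<close> tends to that of \<open>z\<close>, and these points are bounded, so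
  absolutely summable combinations of the coordinates converge as well.
\<close>

lemma fiber_embedding_in_fiber:
  assumes F: "free_limit_filter F" and z: "norm z \<le> 1" and w: "w \<in> ball 0 1"
  shows "fiber_embedding F z w \<in> fiber z"
  unfolding fiber_def
proof (intro CollectI conjI ballI fiber_embedding_in_spectrum[OF assms])
  fix a assume a: "a \<in> ell1"
  let ?x = "\<lambda>i. spread z i (apply_bcontfun w)"
  note x = norm_spread_linf_less_1[OF z w]
  have "(\<lambda>i. c0_nth (?x i) j) \<longlonglongrightarrow> apply_bcontfun z j" for j
  proof -
    have "(\<lambda>i. of_real (radius i) * apply_bcontfun z j) \<longlonglongrightarrow> of_real 1 * apply_bcontfun z j"
      by (intro tendsto_mult tendsto_of_real radius_tendsto tendsto_const)
    moreover have "\<forall>\<^sub>F i in sequentially.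
        of_real (radius i) * apply_bcontfun z j = c0_nth (?x i) j"
      using eventually_gt_at_top[of j] by eventually_elim (simp add: c0_nth_spread_less)
    ultimately show ?thesis using Lim_transform_eventually by fastforce
  qed
  then have "(\<lambda>i. a j * c0_nth (?x i) j) \<longlonglongrightarrow> a j * apply_bcontfun z j" for j
    by (intro tendsto_mult tendsto_const)
  moreover have "norm (a j * c0_nth (?x i) j) \<le> norm (a j)" for i j
    using mult_left_mono[OF order_trans[OF norm_c0_nth_le less_imp_le[OF x]], of "norm (a j)" i j]
    by (simp add: norm_mult)
  then have "\<forall>\<^sub>F (j, i) in sequentially \<times>\<^sub>F sequentially. norm (a j * c0_nth (?x i) j) \<le> norm (a j)"
    by (intro always_eventually) auto
  ultimately have "(\<lambda>i. \<Sum>j. a j * c0_nth (?x i) j) \<longlonglongrightarrow> (\<Sum>j. a j * apply_bcontfun z j)"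
    using tannerys_theorem[of "\<lambda>j i. a j * c0_nth (?x i) j" "\<lambda>j. a j * apply_bcontfun z j"
        sequentially "\<lambda>j. norm (a j)"] a by (simp add: ell1_def)
  then have "(\<lambda>i. ell1_on_ball a (?x i)) \<longlonglongrightarrow> (\<Sum>j. a j * apply_bcontfun z j)"
    using x by (simp add: ell1_on_ball_def)
  then have "((\<lambda>i. ell1_on_ball a (?x i)) \<longlongrightarrow> (\<Sum>j. a j * apply_bcontfun z j)) F"
    by (rule tendsto_mono[rotated]) (use F in \<open>simp add: free_limit_filter_def\<close>)
  then show "fiber_embedding F z w (ell1_on_ball a) = (\<Sum>j. a j * apply_bcontfun z j)"
    by (rule fiber_embedding_eqI[OF F ell1_on_ball_in_Hinf[OF a]])
qed

lemma fiber_embedding_analytic: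
  assumes F: "free_limit_filter F" and z: "norm z \<le> 1"
  shows "analytic_into_spectrum (fiber_embedding F z)"
  unfolding analytic_into_spectrum_def
proof (intro conjI ballI Pi_I)
  show "fiber_embedding F z w \<in> spectrum_Hinf" if "w \<in> ball 0 1" for w
    by (rule fiber_embedding_in_spectrum[OF F z that])
  fix f assume f: "f \<in> Hinf"
  have "hol_map_on (\<lambda>w. Lim F (\<lambda>i. f (spread z i (apply_bcontfun w)))) (ball 0 1)"
  proof (rule hol_map_on_Lim[OF F open_ball])
    show "hol_map_on (\<lambda>w :: linf. f (spread z i (apply_bcontfun w))) (ball 0 1)" for i
      by (rule hol_map_on_compose[OF hol_map_on_spread Hinf_hol_map_on[OF f]])
        (use norm_spread_linf_less_1[OF z] in auto)
  qed (rule norm_le_Hinf_norm[OF f])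
  then show "(\<lambda>w. fiber_embedding F z w f) fholomorphic_on ball 0 1"
    using f by (simp add: fholomorphic_on_iff_hol_map_on fiber_embedding_def)
qed

section \<open>Gleason distances\<close>

lemma gleason_dist_upper:
  assumes "\<And>f. f \<in> Hinf \<Longrightarrow> norm (\<phi> f) \<le> Hinf_norm f" "\<And>f. f \<in> Hinf \<Longrightarrow> norm (\<psi> f) \<le> Hinf_norm f"
    and f: "f \<in> Hinf" "Hinf_norm f \<le> 1"
  shows "norm (\<phi> f - \<psi> f) \<le> gleason_dist \<phi> \<psi>"
  unfolding gleason_dist_def dual_norm_def
proof (rule cSUP_upper)
  have "norm (\<phi> g - \<psi> g) \<le> 2" if "g \<in> Hinf" "Hinf_norm g \<le> 1" for g
    using norm_triangle_ineq4[of "\<phi> g" "\<psi> g"] assms(1,2)[OF that(1)] that(2) by linarith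
  then show "bdd_above ((\<lambda>f. norm (\<phi> f - \<psi> f)) ` {f \<in> Hinf. Hinf_norm f \<le> 1})"
    by (auto simp: bdd_above_def)
qed (use f in simp)

lemma gleason_dist_least:
  assumes "\<And>f. f \<in> Hinf \<Longrightarrow> Hinf_norm f \<le> 1 \<Longrightarrow> norm (\<phi> f - \<psi> f) \<le> c"
  shows "gleason_dist \<phi> \<psi> \<le> c"
  unfolding gleason_dist_def dual_norm_def
proof (rule cSUP_least)
  have "(\<lambda>x. 0) \<in> Hinf" by (rule HinfI[OF hol_map_on_const, of _ 0]) auto
  moreover have "Hinf_norm (\<lambda>x. 0) \<le> 1" by (rule Hinf_norm_le) simp
  ultimately show "{f \<in> Hinf. Hinf_norm f \<le> 1} \<noteq> {}" by blast
qed (use assms in auto)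

lemma gleason_dist_commute: "gleason_dist \<phi> \<psi> = gleason_dist \<psi> \<phi>"
  by (simp add: gleason_dist_def dual_norm_def norm_minus_commute)

lemma delta_at_eqI:
  assumes "f \<in> Hinf" "w \<in> ball 0 1" "(\<lambda>n. f (c0_truncate n w)) \<longlonglongrightarrow> L"
  shows "delta_at w f = L"
  using LIMSEQ_unique[OF Hinf_truncate_convergent[OF assms(1,2)] assms(3)] assms(1)
  by (simp add: delta_at_def)

lemma delta_at_tendsto:
  "f \<in> Hinf \<Longrightarrow> w \<in> ball 0 1 \<Longrightarrow> (\<lambda>n. f (c0_truncate n w)) \<longlonglongrightarrow> delta_at w f"
  using Hinf_truncate_convergent by (simp add: delta_at_def)

lemma norm_delta_at_le:
  assumes "f \<in> Hinf" "w \<in> ball 0 1"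
  shows "norm (delta_at w f) \<le> Hinf_norm f"
  by (rule tendsto_upperbound[OF tendsto_norm[OF delta_at_tendsto[OF assms]]])
    (use norm_le_Hinf_norm[OF assms(1)] in auto)

text \<open>
  For fixed \<open>i\<close>, the composition of \<open>f\<close> with \<open>spread z i\<close> is again in the unit ball of the algebra, and
  its canonical extension at \<open>w\<close> is its value there because only the first \<open>i\<close> coordinates matter.
\<close>

lemma gleason_dist_fiber_embedding_le:
  assumes F: "free_limit_filter F" and z: "norm z \<le> 1" and w: "w \<in> ball 0 1" "v \<in> ball 0 1"
  shows "gleason_dist (fiber_embedding F z w) (fiber_embedding F z v)
    \<le> gleason_dist (delta_at w) (delta_at v)"
proof (rule gleason_dist_least)
  fix f assume f: "f \<in> Hinf" "Hinf_norm f \<le> 1"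
  have "norm (f (spread z i (apply_bcontfun w)) - f (spread z i (apply_bcontfun v)))
      \<le> gleason_dist (delta_at w) (delta_at v)" for i
  proof -
    define g where "g x = (if x \<in> ball 0 1 then f (spread z i (c0_nth x)) else 0)" for x
    have Rep: "Rep_c0 x \<in> ball 0 1" if "x \<in> ball 0 1" for x
      using that by (simp add: norm_c0_def)
    have "hol_map_on (\<lambda>x. f (spread z i (c0_nth x))) (ball 0 1)"
      by (rule hol_map_on_compose[OF hol_map_on_compose[OF hol_map_on_Rep_c0 hol_map_on_spread Rep]
            Hinf_hol_map_on[OF f(1)]])
        (use norm_spread_linf_less_1[OF z Rep] in auto)
    then have g: "g \<in> Hinf"
      unfolding g_def by (rule Hinf_restrictI) (rule norm_le_Hinf_norm[OF f(1)])
    have g1: "Hinf_norm g \<le> 1"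
      using order_trans[OF norm_le_Hinf_norm[OF f(1)] f(2)] by (intro Hinf_norm_le) (simp add: g_def)
    have "delta_at u g = f (spread z i (apply_bcontfun u))" if u: "u \<in> ball 0 1" for u
    proof (rule delta_at_eqI[OF g u])
      have "g (c0_truncate n u) = f (spread z i (apply_bcontfun u))" if "i \<le> n" for n
      proof -
        have "spread z i (c0_nth (c0_truncate n u)) = spread z i (apply_bcontfun u)"
          by (rule spread_cong) (use that in \<open>simp add: c0_nth_truncate\<close>)
        moreover have "norm (c0_truncate n u) < 1"
          using le_less_trans[OF norm_c0_truncate_le] u by simp
        ultimately show ?thesis by (simp add: g_def)
      qed
      then show "(\<lambda>n. g (c0_truncate n u)) \<longlonglongrightarrow> f (spread z i (apply_bcontfun u))"
        by (intro tendsto_eventually eventually_sequentiallyI)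
    qed
    then show ?thesis
      using gleason_dist_upper[OF norm_delta_at_le norm_delta_at_le g g1, OF _ w(1) _ w(2)] w by simp
  qed
  then show "norm (fiber_embedding F z w f - fiber_embedding F z v f)
      \<le> gleason_dist (delta_at w) (delta_at v)"
    by (intro tendsto_upperbound[OF tendsto_norm[OF tendsto_diff[OF
            fiber_embedding_tendsto[OF F f(1)] fiber_embedding_tendsto[OF F f(1)]]]
          _ free_limit_filter_neq_bot[OF F]] always_eventually) blast
qed

text \<open>
  The test function is \<open>f\<close> with its first \<open>n\<close> coordinates replaced by block products starting at \<open>N\<close>
  and the others by \<open>0\<close>. As \<open>N\<close> grows, its values at the two fiber points approach the values of \<open>f\<close>
  at the truncations of \<open>w\<close> and \<open>v\<close>.
\<close>

lemma gleason_dist_fiber_embedding_ge: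
  assumes F: "free_limit_filter F" and z: "norm z \<le> 1" and w: "w \<in> ball 0 1" "v \<in> ball 0 1"
  shows "gleason_dist (delta_at w) (delta_at v)
    \<le> gleason_dist (fiber_embedding F z w) (fiber_embedding F z v)" (is "_ \<le> ?\<gamma>")
proof (rule gleason_dist_least)
  fix f assume f: "f \<in> Hinf" "Hinf_norm f \<le> 1"
  note nb = free_limit_filter_neq_bot[OF F]
  define T where "T N n x = c0_fin {..<n} (\<lambda>k. block_product F z {N..} k x)" for N n x
  define g where "g N n x = (if x \<in> ball 0 1 then f (T N n x) else 0)" for N n x
  have T: "norm (T N n x) < 1" if "norm x < 1" for N n x
    unfolding T_def by (rule norm_c0_fin_less_1) (auto intro: norm_block_product_less_1[OF F that])
  have "hol_map_on (\<lambda>x. f (T N n x)) (ball 0 1)" for N n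
    unfolding T_def
    by (rule hol_map_on_compose[OF hol_map_on_c0_fin[OF hol_map_on_block_product[OF F]]
          Hinf_hol_map_on[OF f(1)]])
      (use T in \<open>auto simp: T_def\<close>)
  then have g: "g N n \<in> Hinf" for N n
    unfolding g_def by (rule Hinf_restrictI) (rule norm_le_Hinf_norm[OF f(1)])
  have g1: "Hinf_norm (g N n) \<le> 1" for N n
    using order_trans[OF norm_le_Hinf_norm[OF f(1)] f(2)] by (intro Hinf_norm_le) (simp add: g_def)
  have near: "\<forall>\<^sub>F N in sequentially. norm (fiber_embedding F z u (g N n) - f (c0_truncate n u)) \<le> e"
    if u: "u \<in> ball 0 1" and e: "0 < e" for u n e
  proof -
    have "norm (c0_truncate n u) < 1" using le_less_trans[OF norm_c0_truncate_le] u by simp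
    then have "isCont f (c0_truncate n u)"
      by (intro hol_map_on_imp_continuous[OF Hinf_hol_map_on[OF f(1)]]) simp
    then obtain d where d: "d > 0"
      and fd: "\<And>y. dist y (c0_truncate n u) < d \<Longrightarrow> dist (f y) (f (c0_truncate n u)) < e"
      using e unfolding continuous_at_eps_delta by blast
    have "\<forall>\<^sub>F N in sequentially. (1 / 2 :: real) ^ N < d"
      by (rule order_tendstoD(2)[OF LIMSEQ_power_zero]) (use d in auto)
    then show ?thesis
    proof (rule eventually_mono)
      fix N assume N: "(1 / 2 :: real) ^ N < d"
      have le: "norm (g N n (spread z i (apply_bcontfun u)) - f (c0_truncate n u)) \<le> e"
        if i: "max n N \<le> i" for i
      proof -
        let ?x = "spread z i (apply_bcontfun u)"
        have "norm (T N n ?x - c0_truncate n u) \<le> (1 / 2) ^ N"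
        proof (rule norm_c0_le)
          fix k
          show "norm (c0_nth (T N n ?x - c0_truncate n u) k) \<le> (1 / 2) ^ N"
            using block_product_spread[where w = "apply_bcontfun u", OF F z norm_nth_less_1[OF u]
                order_refl, of k i N] i
            by (simp add: T_def c0_nth_fin c0_nth_truncate minus_bcontfun.rep_eq)
        qed
        then have "dist (f (T N n ?x)) (f (c0_truncate n u)) < e"
          using N by (intro fd) (simp add: dist_norm)
        then show ?thesis
          using norm_spread_linf_less_1[OF z u] by (simp add: g_def dist_norm)
      qed
      have ev: "\<forall>\<^sub>F i in F. norm (g N n (spread z i (apply_bcontfun u)) - f (c0_truncate n u)) \<le> e"
        by (rule eventually_mono[OF eventually_ge_free_limit_filter[OF F] le])
      show "norm (fiber_embedding F z u (g N n) - f (c0_truncate n u)) \<le> e"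
        by (rule tendsto_upperbound[OF tendsto_norm[OF tendsto_diff[OF
                fiber_embedding_tendsto[OF F g] tendsto_const]] ev nb])
    qed
  qed
  have "norm (f (c0_truncate n w) - f (c0_truncate n v)) \<le> ?\<gamma>" for n
  proof (rule field_le_epsilon)
    fix e :: real assume "0 < e"
    then have e2: "0 < e / 2" by simp
    obtain N where N: "norm (fiber_embedding F z w (g N n) - f (c0_truncate n w)) \<le> e / 2"
        "norm (fiber_embedding F z v (g N n) - f (c0_truncate n v)) \<le> e / 2"
      using eventually_happens'[OF sequentially_bot
          eventually_conj[OF near[OF w(1) e2] near[OF w(2) e2]]] by blast
    let ?a = "fiber_embedding F z w (g N n)" and ?b = "fiber_embedding F z v (g N n)"
    have "norm (?a - ?b) \<le> ?\<gamma>"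
      by (rule gleason_dist_upper[OF norm_fiber_embedding_le[OF F] norm_fiber_embedding_le[OF F] g g1])
    then have "norm ((?a - ?b) - (?a - f (c0_truncate n w)) + (?b - f (c0_truncate n v))) \<le> ?\<gamma> + e"
      using N norm_triangle_ineq[of "(?a - ?b) - (?a - f (c0_truncate n w))" "?b - f (c0_truncate n v)"]
        norm_triangle_ineq4[of "?a - ?b" "?a - f (c0_truncate n w)"] by linarith
    then show "norm (f (c0_truncate n w) - f (c0_truncate n v)) \<le> ?\<gamma> + e" by simp
  qed
  then show "norm (delta_at w f - delta_at v f) \<le> ?\<gamma>"
    by (intro tendsto_upperbound[OF tendsto_norm[OF tendsto_diff[OF
            delta_at_tendsto[OF f(1) w(1)] delta_at_tendsto[OF f(1) w(2)]]]]) auto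
qed

lemma fiber_embedding_gleason_isometry:
  assumes F: "free_limit_filter F" and z: "norm z \<le> 1"
  shows "gleason_isometry (fiber_embedding F z)"
  unfolding gleason_isometry_def
proof (intro conjI ballI Pi_I)
  show "fiber_embedding F z w \<in> spectrum_Hinf" if "w \<in> ball 0 1" for w
    by (rule fiber_embedding_in_spectrum[OF F z that])
  show "gleason_dist (fiber_embedding F z w) (fiber_embedding F z v)
      = gleason_dist (delta_at w) (delta_at v)" if "w \<in> ball 0 1" "v \<in> ball 0 1" for w v
    by (rule antisym[OF gleason_dist_fiber_embedding_le[OF F z that]
          gleason_dist_fiber_embedding_ge[OF F z that]])
qed

text \<open>
  The block product \<open>B\<close> over \<open>A\<close> from \<open>N\<close> on is close to the first entry \<open>u\<close> of \<open>w\<close> at the first fiber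
  point and close to \<open>1\<close> at the second. An automorphism of the disc with parameter \<open>r\<close> near \<open>1\<close> sends
  \<open>u\<close> close to \<open>1\<close> but \<open>1\<close> to \<open>-1\<close>.
\<close>

lemma gleason_dist_fiber_embedding_2:
  assumes F: "free_limit_filter F\<^sub>1" "free_limit_filter F\<^sub>2" and z: "norm z \<le> 1"
    and w: "w \<in> ball 0 1" "v \<in> ball 0 1"
    and A: "\<forall>\<^sub>F i in F\<^sub>1. i \<in> A" "\<forall>\<^sub>F i in F\<^sub>2. i \<notin> A"
  shows "2 \<le> gleason_dist (fiber_embedding F\<^sub>1 z w) (fiber_embedding F\<^sub>2 z v)" (is "_ \<le> ?\<gamma>")
proof (rule field_le_epsilon)
  fix e :: real assume "0 < e"
  then have e3: "0 < e / 3" by simp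
  define u where "u = apply_bcontfun w 0"
  have u: "norm u < 1" unfolding u_def by (rule norm_nth_less_1[OF w(1)])
  have "\<forall>\<^sub>F r in at_left (1::real). dist (disc_inv r u) 1 < e / 3"
    by (rule tendstoD[OF disc_inv_tendsto_1[OF u] e3])
  moreover have "\<forall>\<^sub>F r in at_left (1::real). r \<in> {0<..<1}"
    by (rule eventually_at_left_real) simp
  ultimately have "\<forall>\<^sub>F r in at_left (1::real). dist (disc_inv r u) 1 < e / 3 \<and> r \<in> {0<..<1}"
    by (rule eventually_conj)
  from eventually_happens'[OF trivial_limit_at_left_real this]
  obtain r where r: "0 < r" "r < 1" and ru: "norm (disc_inv r u - 1) < e / 3"
    by (auto simp: dist_norm)
  have cont: "isCont (disc_inv r) y" if "norm y \<le> 1" for y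
    unfolding disc_inv_def using disc_inv_denom[OF r that] by (intro continuous_intros) auto
  obtain d1 where d1: "d1 > 0" "\<And>y. norm (y - u) < d1 \<Longrightarrow> norm (disc_inv r y - disc_inv r u) < e / 3"
    using cont[OF less_imp_le[OF u], unfolded continuous_at_eps_delta, rule_format, OF e3]
    unfolding dist_norm by blast
  have "isCont (disc_inv r) 1" by (rule cont) simp
  then obtain d2 where d2: "d2 > 0" "\<And>y. norm (y - 1) < d2 \<Longrightarrow> norm (disc_inv r y + 1) < e / 3"
    using e3 unfolding continuous_at_eps_delta dist_norm disc_inv_at_1[OF r] diff_minus_eq_add
    by blast
  obtain N where N: "(1 / 2 :: real) ^ N < min d1 d2"
    using real_arch_pow_inv[of "min d1 d2" "1 / 2"] d1(1) d2(1) by auto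
  define B where "B = block_product F\<^sub>1 z (A \<inter> {N..}) 0"
  have ne: "A \<inter> {N..} \<noteq> {}"
  proof -
    have "\<exists>i. i \<in> A \<and> N \<le> i"
      by (rule eventually_happens'[OF free_limit_filter_neq_bot[OF F(1)] eventually_conj[OF A(1)
            eventually_ge_free_limit_filter[OF F(1), of N]]])
    then show ?thesis by auto
  qed
  have B: "norm (B x) < 1" if "norm x < 1" for x
    unfolding B_def by (rule norm_block_product_less_1[OF F(1) that ne])
  define f where "f x = (if x \<in> ball 0 1 then disc_inv r (B x) else 0)" for x
  have f: "f \<in> Hinf"
    unfolding f_def
  proof (rule Hinf_restrictI)
    show "hol_map_on (\<lambda>x. disc_inv r (B x)) (ball 0 1)"
      using B by (intro hol_map_on_disc_inv r) (auto simp: B_def intro: hol_map_on_block_product F)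
    show "norm (disc_inv r (B x)) \<le> 1" if "norm x < 1" for x
      using disc_inv_norm_less_1[OF r B[OF that]] by simp
  qed
  have f1: "Hinf_norm f \<le> 1"
    using disc_inv_norm_less_1[OF r B] by (intro Hinf_norm_le) (simp add: f_def less_imp_le)
  have B_spread: "norm (B (spread z i (apply_bcontfun y)) - (if i \<in> A then apply_bcontfun y 0 else 1))
      < min d1 d2" if "y \<in> ball 0 1" "Suc N \<le> i" for i y
    using block_product_spread[where w = "apply_bcontfun y", OF F(1) z norm_nth_less_1[OF that(1)],
        of "A \<inter> {N..}" N 0 i] that(2) N
    unfolding B_def by auto
  have le1: "norm (f (spread z i (apply_bcontfun w)) - 1) \<le> 2 * e / 3" if "i \<in> A" "Suc N \<le> i" for i
  proof -
    have "norm (disc_inv r (B (spread z i (apply_bcontfun w))) - disc_inv r u) < e / 3"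
      using B_spread[OF w(1) that(2)] that(1) by (intro d1(2)) (simp add: u_def)
    then have "norm (disc_inv r (B (spread z i (apply_bcontfun w))) - 1) \<le> e / 3 + e / 3"
      using ru norm_triangle_ineq[of "disc_inv r (B (spread z i (apply_bcontfun w))) - disc_inv r u"
          "disc_inv r u - 1"] by simp
    then show ?thesis using norm_spread_linf_less_1[OF z w(1)] by (simp add: f_def)
  qed
  have ev1: "\<forall>\<^sub>F i in F\<^sub>1. norm (f (spread z i (apply_bcontfun w)) - 1) \<le> 2 * e / 3"
    using A(1) eventually_ge_free_limit_filter[OF F(1), of "Suc N"] by eventually_elim (rule le1)
  have 1: "norm (fiber_embedding F\<^sub>1 z w f - 1) \<le> 2 * e / 3"
    by (rule tendsto_upperbound[OF tendsto_norm[OF tendsto_diff[OF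
            fiber_embedding_tendsto[OF F(1) f] tendsto_const]] ev1 free_limit_filter_neq_bot[OF F(1)]])
  have le2: "norm (f (spread z i (apply_bcontfun v)) + 1) \<le> e / 3" if "i \<notin> A" "Suc N \<le> i" for i
  proof -
    have "norm (disc_inv r (B (spread z i (apply_bcontfun v))) + 1) < e / 3"
      using B_spread[OF w(2) that(2)] that(1) by (intro d2(2)) simp
    then show ?thesis using norm_spread_linf_less_1[OF z w(2)] by (simp add: f_def)
  qed
  have ev2: "\<forall>\<^sub>F i in F\<^sub>2. norm (f (spread z i (apply_bcontfun v)) + 1) \<le> e / 3"
    using A(2) eventually_ge_free_limit_filter[OF F(2), of "Suc N"] by eventually_elim (rule le2)
  have 2: "norm (fiber_embedding F\<^sub>2 z v f + 1) \<le> e / 3"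
    by (rule tendsto_upperbound[OF tendsto_norm[OF tendsto_add[OF
            fiber_embedding_tendsto[OF F(2) f] tendsto_const]] ev2 free_limit_filter_neq_bot[OF F(2)]])
  have "norm (fiber_embedding F\<^sub>1 z w f - fiber_embedding F\<^sub>2 z v f) \<le> ?\<gamma>"
    by (rule gleason_dist_upper[OF norm_fiber_embedding_le[OF F(1)] norm_fiber_embedding_le[OF F(2)] f f1])
  moreover have "norm (2 :: complex) \<le> norm (fiber_embedding F\<^sub>1 z w f - fiber_embedding F\<^sub>2 z v f)
      + (norm (fiber_embedding F\<^sub>1 z w f - 1) + norm (fiber_embedding F\<^sub>2 z v f + 1))"
    using norm_triangle_ineq[of "fiber_embedding F\<^sub>1 z w f - fiber_embedding F\<^sub>2 z v f"
        "- (fiber_embedding F\<^sub>1 z w f - 1) + (fiber_embedding F\<^sub>2 z v f + 1)"]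
      norm_triangle_ineq[of "- (fiber_embedding F\<^sub>1 z w f - 1)" "fiber_embedding F\<^sub>2 z v f + 1"]
    by (simp add: norm_minus_commute)
  ultimately show "2 \<le> ?\<gamma> + e" using 1 2 by simp
qed

theorem theorem1p1:
  fixes z :: linf
  assumes "z \<in> cball 0 1"
  shows "\<exists>\<Phi> \<in> beta_nat_minus_nat \<times> ball (0::linf) 1 \<rightarrow> fiber z.
    (\<forall>\<eta>\<in>beta_nat_minus_nat.
        analytic_into_spectrum (\<lambda>w. \<Phi> (\<eta>, w)) \<and> gleason_isometry (\<lambda>w. \<Phi> (\<eta>, w))) \<and>
    (\<forall>\<eta>\<^sub>1\<in>beta_nat_minus_nat. \<forall>\<eta>\<^sub>2\<in>beta_nat_minus_nat. \<eta>\<^sub>1 \<noteq> \<eta>\<^sub>2 \<longrightarrow>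
        in_different_gleason_parts
          ((\<lambda>w. \<Phi> (\<eta>\<^sub>1, w)) ` ball 0 1) ((\<lambda>w. \<Phi> (\<eta>\<^sub>2, w)) ` ball 0 1))"
proof -
  have z: "norm z \<le> 1" using assms by simp
  let ?\<Phi> = "\<lambda>\<eta> w. fiber_embedding (remainder_filter \<eta>) z w"
  have "in_different_gleason_parts (?\<Phi> \<eta>\<^sub>1 ` ball 0 1) (?\<Phi> \<eta>\<^sub>2 ` ball 0 1)"
    if \<eta>: "\<eta>\<^sub>1 \<in> beta_nat_minus_nat" "\<eta>\<^sub>2 \<in> beta_nat_minus_nat" "\<eta>\<^sub>1 \<noteq> \<eta>\<^sub>2" for \<eta>\<^sub>1 \<eta>\<^sub>2
  proof -
    obtain A where A: "\<forall>\<^sub>F n in remainder_filter \<eta>\<^sub>1. n \<in> A" "\<forall>\<^sub>F n in remainder_filter \<eta>\<^sub>2. n \<notin> A"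
      by (rule remainder_filters_separated[OF \<eta>])
    have "2 \<le> gleason_dist (?\<Phi> \<eta>\<^sub>1 w) (?\<Phi> \<eta>\<^sub>2 v)" if "w \<in> ball 0 1" "v \<in> ball 0 1" for w v
      by (rule gleason_dist_fiber_embedding_2[OF remainder_free_limit_filter[OF \<eta>(1)]
            remainder_free_limit_filter[OF \<eta>(2)] z that A])
    then show ?thesis
      unfolding in_different_gleason_parts_def gleason_part_def
      by (auto simp: not_less gleason_dist_commute[of "?\<Phi> \<eta>\<^sub>2 _"] simp del: mem_ball)
  qed
  then show ?thesis
    using fiber_embedding_in_fiber[OF remainder_free_limit_filter z]
      fiber_embedding_analytic[OF remainder_free_limit_filter z]
      fiber_embedding_gleason_isometry[OF remainder_free_limit_filter z]
    by (intro bexI[of _ "\<lambda>(\<eta>, w). ?\<Phi> \<eta> w"]) (auto simp del: mem_ball)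
qed

end
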